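(* Let $\varphi$ be an LTL formula over $2^{V_i}$ and let $\mathcal{A}_\varphi$ be an ACA with $\mathcal{L}(\mathcal{A}_\varphi)=\mathcal{L}(\varphi)$. Let $\mathcal{A}_{dd}$ be the delay-dominance UCA for $\mathcal{A}_\varphi$ and $p_i$ as defined in the context. Then for every strategy $s$ for process $p_i$: $\mathcal{A}_{dd}$ accepts $\mathrm{comp}(s,\gamma)$ for all $\gamma\in(2^{I_i})^\omega$ if and only if $s$ is delay-dominant for $\mathcal{A}_\varphi$ and $p_i$.
   Context: Automata. For a finite set $\Sigma$ of atomic propositions, an alternating co-Büchi automaton (ACA) over $2^\Sigma$ is a tuple $\mathcal{A}=(Q,q_0,\delta,F)$ with a finite set of states $Q$, initial state $q_0\in Q$, set of rejecting states $F\subseteq Q$, and transition function $\delta:Q\times 2^\Sigma\to\mathbb{B}^+(Q)$ into positive Boolean formulas over $Q$ given in disjunctive normal form; $\delta(q,a)$ is identified with the set of its disjuncts, each disjunct $c\in\delta(q,a)$ being a set of states. A run tree of $\mathcal{A}$ on $\sigma=\sigma_0\sigma_1\cdots\in(2^\Sigma)^\omega$ is a $Q$-labeled tree $(T,\ell)$ ($T\subseteq\mathbb{N}^*$ prefix-closed) with $\ell(\varepsilon)=q_0$ and $\{\ell(x')\mid x'\text{ a child of }x\}\in\delta(\ell(x),\sigma_{|x|})$ for every node $x$; it is accepting if every infinite branch visits $F$ only finitely often. $\mathcal{A}$ accepts $\sigma$ if some run tree on $\sigma$ is accepting; $\mathcal{L}(\mathcal{A})$ is the set of accepted words. For an LTL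 formula $\varphi$, $\mathcal{L}(\varphi)$ is the set of infinite words satisfying $\varphi$. (As implicit in the game below, each $\delta(q,a)$ and each of its disjuncts is nonempty.) A universal co-Büchi automaton (UCA) over $2^\Sigma$ is $(Q,q_0,\delta,F)$ with transition relation $\delta\subseteq Q\times 2^\Sigma\times Q$; it accepts $\sigma$ if every run $q_0q_1\cdots$ (with $(q_j,\sigma_j,q_{j+1})\in\delta$) visits $F$ only finitely often. For $X\subset\Sigma$, the universal projection $\pi_X$ of a UCA $(Q,q_0,\delta,F)$ is the UCA $(Q,q_0,\pi_X(\delta),F)$ over $2^X$ with $\pi_X(\delta)=\{(q,a,q')\in Q\times 2^X\times Q\mid\exists b\in 2^{\Sigma\setminus X}.\ (q,a\cup b,q')\in\delta\}$. Processes and strategies. A process $p_i$ has disjoint finite sets $I_i$ of input and $O_i$ of output variables; $V_i=I_i\cup O_i$. A strategy for $p_i$ is a function $s:(2^{I_i})^*\to 2^{O_i}$ representable by a finite Moore machine. For $\gamma\in(2^{I_i})^\omega$ the computation $\mathrm{comp}(s,\gamma)\in(2^{V_i})^\omega$ is given by $\mathrm{comp}(s,\gamma)_j=\gamma_j\cup s(\gamma_0\cdots\gamma_{j-1})$ for all $j\ge 0$. Delay-dominance game. Let $\mathcal{A}=(Q,q_0,\delta,F)$ be an ACA and $\sigma,\sigma'$ infinite words over its alphabet. The game $(\mathcal{A},\sigma,\sigma')$ is played between Duplicator (Player 0) and Spoiler (Player 1) on positions of the forms $((p,q),j)$ and $((p,q,c,c'),j)$ (owned by Spoiler) and $((p,q,c),j)$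 and $((p,q,c,q'),j)$ (owned by Duplicator), with $p,q,q'\in Q$, $c,c'\subseteq Q$, $j\in\mathbb{N}$. Moves: from $((p,q),j)$ to $((p,q,c),j)$ with $c\in\delta(p,\sigma_j)$; from $((p,q,c),j)$ to $((p,q,c,c'),j)$ with $c'\in\delta(q,\sigma'_j)$; from $((p,q,c,c'),j)$ to $((p,q,c,q'),j)$ with $q'\in c'$; from $((p,q,c,q'),j)$ to $((p',q'),j+1)$ with $p'\in c$. The initial position is $((q_0,q_0),0)$. For a position whose state tuple is $(p,q)$, $(p,q,c)$, $(p,q,c,c')$ or $(p,q,c,q')$, its alternative state is $p$ and its dominant state is $q$. A play $\rho_0\rho_1\cdots$ is won by Duplicator iff for every $k$ such that the dominant state of $\rho_k$ lies in $F$ there is $k'\ge k$ such that the alternative state of $\rho_{k'}$ lies in $F$. A Duplicator strategy is winning if every play from the initial position consistent with it is won by Duplicator. Delay-dominance. For strategies $s,t$ of $p_i$, an ACA $\mathcal{A}$ over $2^{V_i}$ and $\gamma\in(2^{I_i})^\omega$: $s$ delay-dominates $t$ on $\gamma$ if Duplicator has a winning strategy in $(\mathcal{A},\mathrm{comp}(t,\gamma),\mathrm{comp}(s,\gamma))$; $s$ is delay-dominant for $\mathcal{A}$ (and $p_i$) if it delay-dominates every strategy $t$ for $p_i$ on every $\gamma$. Primed variables. $O_i'=\{o'\mid o\in O_i\}$ is a set of fresh symbols, $V_i'=I_i\cup O_i'$; $\mathrm{unpr}$ replaces every $o'\in O_i'$ by $o$. Construction. Let $\mathcal{A}_\varphi=(Q,q_0,\delta,F)$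 and let $\mathcal{A}_{\neg\varphi}=(Q^c,q^c_0,\delta^c,F^c)$ be an ACA over $2^{V_i}$ with $\mathcal{L}(\mathcal{A}_{\neg\varphi})=\mathcal{L}(\neg\varphi)$, $Q^c$ disjoint from $Q\times Q\times\{\top,\bot\}$. Define $\vartheta(p,q,m)=(p,q,\bot)$ if $p\notin F$, $q\in F$, $m=\top$; $\vartheta(p,q,m)=(p,q,\bot)$ if $p\notin F$ and $m=\bot$; $\vartheta(p,q,m)=(p,q,\top)$ otherwise. $\mathcal{B}$ is the ACA over $2^{V_i\cup O_i'}$ with states $(Q\times Q\times\{\top,\bot\})\cup Q^c$, initial state $(q_0,q_0,\top)$, rejecting states $(Q\times Q\times\{\bot\})\cup F^c$, and, for a letter $\tilde\iota$ with $\iota=\tilde\iota\cap V_i$ and $\iota'=\mathrm{unpr}(\tilde\iota\cap V_i')$: $\delta_{\mathcal{B}}(q_c,\tilde\iota)=\delta^c(q_c,\iota')$ for $q_c\in Q^c$; $\delta_{\mathcal{B}}((q_0,q_0,\top),\tilde\iota)=\delta^c(q^c_0,\iota')\vee\bigwedge_{c\in\delta(q_0,\iota')}\bigvee_{c'\in\delta(q_0,\iota)}\bigwedge_{q'\in c'}\bigvee_{p'\in c}\vartheta(p',q',\top)$; and $\delta_{\mathcal{B}}((p,q,m),\tilde\iota)=\bigwedge_{c\in\delta(p,\iota')}\bigvee_{c'\in\delta(q,\iota)}\bigwedge_{q'\in c'}\bigvee_{p'\in c}\vartheta(p',q',m)$ for the other states $(p,q,m)$. Let $\mathcal{B}'$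 be any UCA over $2^{V_i\cup O_i'}$ with $\mathcal{L}(\mathcal{B}')=\mathcal{L}(\mathcal{B})$. The delay-dominance UCA is $\mathcal{A}_{dd}=\pi_{V_i}(\mathcal{B}')$, a UCA over $2^{V_i}$. *)

theory Defs
  imports Main
begin

type_synonym 'v word = "nat \<Rightarrow> 'v set"

datatype 'v ltl = LTrue | LProp 'v | LNot "'v ltl" | LAnd "'v ltl" "'v ltl"
  | LNext "'v ltl" | LUntil "'v ltl" "'v ltl"

fun ltl_atoms :: "'v ltl \<Rightarrow> 'v set" where
  "ltl_atoms LTrue = {}"
| "ltl_atoms (LProp v) = {v}"
| "ltl_atoms (LNot f) = ltl_atoms f"
| "ltl_atoms (LAnd f g) = ltl_atoms f \<union> ltl_atoms g"
| "ltl_atoms (LNext f) = ltl_atoms f"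
| "ltl_atoms (LUntil f g) = ltl_atoms f \<union> ltl_atoms g"

fun ltl_sat :: "'v word \<Rightarrow> 'v ltl \<Rightarrow> bool" where
  "ltl_sat w LTrue = True"
| "ltl_sat w (LProp v) = (v \<in> w 0)"
| "ltl_sat w (LNot f) = (\<not> ltl_sat w f)"
| "ltl_sat w (LAnd f g) = (ltl_sat w f \<and> ltl_sat w g)"
| "ltl_sat w (LNext f) = ltl_sat (\<lambda>j. w (Suc j)) f"
| "ltl_sat w (LUntil f g) =
     (\<exists>k. ltl_sat (\<lambda>j. w (j + k)) g \<and> (\<forall>i<k. ltl_sat (\<lambda>j. w (j + i)) f))"

definition word_over :: "'v set \<Rightarrow> 'v word \<Rightarrow> bool" where
  "word_over \<Sigma> w \<longleftrightarrow> (\<forall>j. w j \<subseteq> \<Sigma>)"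

definition ltl_lang :: "'v set \<Rightarrow> 'v ltl \<Rightarrow> 'v word set" where
  "ltl_lang \<Sigma> \<phi> = {w. word_over \<Sigma> w \<and> ltl_sat w \<phi>}"

text \<open>The transition function is in DNF: trans q a is the set of disjuncts,
  each disjunct a set of states.\<close>
record ('q, 'v) aca =
  aca_states :: "'q set"
  aca_init :: 'q
  aca_trans :: "'q \<Rightarrow> 'v set \<Rightarrow> 'q set set"
  aca_rej :: "'q set"

definition aca_wf :: "'v set \<Rightarrow> ('q, 'v) aca \<Rightarrow> bool" where
  "aca_wf \<Sigma> A \<longleftrightarrow> finite (aca_states A) \<and> aca_init A \<in> aca_states A
     \<and> aca_rej A \<subseteq> aca_states A
     \<and> (\<forall>q \<in> aca_states A. \<forall>a. a \<subseteq> \<Sigma> \<longrightarrow>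
          aca_trans A q a \<noteq> {} \<and> finite (aca_trans A q a)
          \<and> (\<forall>c \<in> aca_trans A q a. c \<noteq> {} \<and> c \<subseteq> aca_states A))"

definition aca_run_tree :: "('q, 'v) aca \<Rightarrow> 'v word \<Rightarrow> nat list set \<Rightarrow> (nat list \<Rightarrow> 'q) \<Rightarrow> bool" where
  "aca_run_tree A \<sigma> T l \<longleftrightarrow> [] \<in> T \<and> (\<forall>x y. x @ y \<in> T \<longrightarrow> x \<in> T)
     \<and> l [] = aca_init A
     \<and> (\<forall>x \<in> T. {l (x @ [n]) | n. x @ [n] \<in> T} \<in> aca_trans A (l x) (\<sigma> (length x)))"

definition tree_branch :: "nat list set \<Rightarrow> (nat \<Rightarrow> nat list) \<Rightarrow> bool" where
  "tree_branch T \<beta> \<longleftrightarrow> \<beta> 0 = [] \<and> (\<forall>k. \<exists>n. \<beta> (Suc k) = \<beta> k @ [n]) \<and> (\<forall>k. \<beta> k \<in> T)"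

definition aca_run_accepting :: "('q, 'v) aca \<Rightarrow> nat list set \<Rightarrow> (nat list \<Rightarrow> 'q) \<Rightarrow> bool" where
  "aca_run_accepting A T l \<longleftrightarrow>
     (\<forall>\<beta>. tree_branch T \<beta> \<longrightarrow> finite {k. l (\<beta> k) \<in> aca_rej A})"

definition aca_accepts :: "('q, 'v) aca \<Rightarrow> 'v word \<Rightarrow> bool" where
  "aca_accepts A \<sigma> \<longleftrightarrow> (\<exists>T l. aca_run_tree A \<sigma> T l \<and> aca_run_accepting A T l)"

definition aca_lang :: "'v set \<Rightarrow> ('q, 'v) aca \<Rightarrow> 'v word set" where
  "aca_lang \<Sigma> A = {w. word_over \<Sigma> w \<and> aca_accepts A w}"

record ('q, 'v) uca =
  uca_states :: "'q set"
  uca_init :: 'q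
  uca_trans :: "('q \<times> 'v set \<times> 'q) set"
  uca_rej :: "'q set"

definition uca_wf :: "'v set \<Rightarrow> ('q, 'v) uca \<Rightarrow> bool" where
  "uca_wf \<Sigma> A \<longleftrightarrow> finite (uca_states A) \<and> uca_init A \<in> uca_states A
     \<and> uca_rej A \<subseteq> uca_states A
     \<and> uca_trans A \<subseteq> uca_states A \<times> Pow \<Sigma> \<times> uca_states A"

definition uca_run :: "('q, 'v) uca \<Rightarrow> 'v word \<Rightarrow> (nat \<Rightarrow> 'q) \<Rightarrow> bool" where
  "uca_run A \<sigma> r \<longleftrightarrow> r 0 = uca_init A \<and> (\<forall>j. (r j, \<sigma> j, r (Suc j)) \<in> uca_trans A)"

definition uca_accepts :: "('q, 'v) uca \<Rightarrow> 'v word \<Rightarrow> bool" where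
  "uca_accepts A \<sigma> \<longleftrightarrow> (\<forall>r. uca_run A \<sigma> r \<longrightarrow> finite {j. r j \<in> uca_rej A})"

definition uca_lang :: "'v set \<Rightarrow> ('q, 'v) uca \<Rightarrow> 'v word set" where
  "uca_lang \<Sigma> A = {w. word_over \<Sigma> w \<and> uca_accepts A w}"

definition uca_proj :: "'v set \<Rightarrow> 'v set \<Rightarrow> ('q, 'v) uca \<Rightarrow> ('q, 'v) uca" where
  "uca_proj \<Sigma> X A = A\<lparr>uca_trans :=
     {(q, a, q'). a \<subseteq> X \<and> (\<exists>b. b \<subseteq> \<Sigma> - X \<and> (q, a \<union> b, q') \<in> uca_trans A)}\<rparr>"

definition finite_moore :: "'v set \<Rightarrow> ('v set list \<Rightarrow> 'v set) \<Rightarrow> bool" where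
  "finite_moore Ii s \<longleftrightarrow> (\<exists>(S :: nat set) m0 tr out. finite S \<and> m0 \<in> S
     \<and> (\<forall>m \<in> S. \<forall>a. a \<subseteq> Ii \<longrightarrow> tr m a \<in> S)
     \<and> (\<forall>w \<in> lists (Pow Ii). s w = out (foldl tr m0 w)))"

definition is_strategy :: "'v set \<Rightarrow> 'v set \<Rightarrow> ('v set list \<Rightarrow> 'v set) \<Rightarrow> bool" where
  "is_strategy Ii Oo s \<longleftrightarrow> (\<forall>w \<in> lists (Pow Ii). s w \<subseteq> Oo) \<and> finite_moore Ii s"

definition computation :: "('v set list \<Rightarrow> 'v set) \<Rightarrow> 'v word \<Rightarrow> 'v word" where
  "computation s \<gamma> j = \<gamma> j \<union> s (map \<gamma> [0..<j])"

datatype 'q gpos =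
    GP 'q 'q nat                       \<comment> \<open>((p,q),j), Spoiler\<close>
  | GPC 'q 'q "'q set" nat             \<comment> \<open>((p,q,c),j), Duplicator\<close>
  | GPCC 'q 'q "'q set" "'q set" nat   \<comment> \<open>((p,q,c,c'),j), Spoiler\<close>
  | GPCQ 'q 'q "'q set" 'q nat         \<comment> \<open>((p,q,c,q'),j), Duplicator\<close>

fun gmove :: "('q, 'v) aca \<Rightarrow> 'v word \<Rightarrow> 'v word \<Rightarrow> 'q gpos \<Rightarrow> 'q gpos \<Rightarrow> bool" where
  "gmove A \<sigma> \<sigma>' (GP p q j) y = (\<exists>c \<in> aca_trans A p (\<sigma> j). y = GPC p q c j)"
| "gmove A \<sigma> \<sigma>' (GPC p q c j) y = (\<exists>c' \<in> aca_trans A q (\<sigma>' j). y = GPCC p q c c' j)"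
| "gmove A \<sigma> \<sigma>' (GPCC p q c c' j) y = (\<exists>q' \<in> c'. y = GPCQ p q c q' j)"
| "gmove A \<sigma> \<sigma>' (GPCQ p q c q' j) y = (\<exists>p' \<in> c. y = GP p' q' (Suc j))"

fun dup_pos :: "'q gpos \<Rightarrow> bool" where
  "dup_pos (GP p q j) = False"
| "dup_pos (GPC p q c j) = True"
| "dup_pos (GPCC p q c c' j) = False"
| "dup_pos (GPCQ p q c q' j) = True"

fun alt_st :: "'q gpos \<Rightarrow> 'q" where
  "alt_st (GP p q j) = p"
| "alt_st (GPC p q c j) = p"
| "alt_st (GPCC p q c c' j) = p"
| "alt_st (GPCQ p q c q' j) = p"

fun dom_st :: "'q gpos \<Rightarrow> 'q" where
  "dom_st (GP p q j) = q"
| "dom_st (GPC p q c j) = q"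
| "dom_st (GPCC p q c c' j) = q"
| "dom_st (GPCQ p q c q' j) = q"

definition game_play :: "('q, 'v) aca \<Rightarrow> 'v word \<Rightarrow> 'v word \<Rightarrow> (nat \<Rightarrow> 'q gpos) \<Rightarrow> bool" where
  "game_play A \<sigma> \<sigma>' \<rho> \<longleftrightarrow> \<rho> 0 = GP (aca_init A) (aca_init A) 0
     \<and> (\<forall>k. gmove A \<sigma> \<sigma>' (\<rho> k) (\<rho> (Suc k)))"

definition dup_strategy :: "('q, 'v) aca \<Rightarrow> 'v word \<Rightarrow> 'v word \<Rightarrow> ('q gpos list \<Rightarrow> 'q gpos) \<Rightarrow> bool" where
  "dup_strategy A \<sigma> \<sigma>' str \<longleftrightarrow> (\<forall>h. h \<noteq> [] \<and> dup_pos (last h) \<and> (\<exists>y. gmove A \<sigma> \<sigma>' (last h) y)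
      \<longrightarrow> gmove A \<sigma> \<sigma>' (last h) (str h))"

definition consistent_with :: "('q gpos list \<Rightarrow> 'q gpos) \<Rightarrow> (nat \<Rightarrow> 'q gpos) \<Rightarrow> bool" where
  "consistent_with str \<rho> \<longleftrightarrow>
     (\<forall>k. dup_pos (\<rho> k) \<longrightarrow> \<rho> (Suc k) = str (map \<rho> [0..<Suc k]))"

definition dup_wins_play :: "('q, 'v) aca \<Rightarrow> (nat \<Rightarrow> 'q gpos) \<Rightarrow> bool" where
  "dup_wins_play A \<rho> \<longleftrightarrow>
     (\<forall>k. dom_st (\<rho> k) \<in> aca_rej A \<longrightarrow> (\<exists>k' \<ge> k. alt_st (\<rho> k') \<in> aca_rej A))"

definition dup_wins_game :: "('q, 'v) aca \<Rightarrow> 'v word \<Rightarrow> 'v word \<Rightarrow> bool" where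
  "dup_wins_game A \<sigma> \<sigma>' \<longleftrightarrow> (\<exists>str. dup_strategy A \<sigma> \<sigma>' str \<and>
     (\<forall>\<rho>. game_play A \<sigma> \<sigma>' \<rho> \<and> consistent_with str \<rho> \<longrightarrow> dup_wins_play A \<rho>))"

definition delay_dominates ::
  "('q, 'v) aca \<Rightarrow> ('v set list \<Rightarrow> 'v set) \<Rightarrow> ('v set list \<Rightarrow> 'v set) \<Rightarrow> 'v word \<Rightarrow> bool" where
  "delay_dominates A s t \<gamma> \<longleftrightarrow> dup_wins_game A (computation t \<gamma>) (computation s \<gamma>)"

definition delay_dominant ::
  "'v set \<Rightarrow> 'v set \<Rightarrow> ('q, 'v) aca \<Rightarrow> ('v set list \<Rightarrow> 'v set) \<Rightarrow> bool" where
  "delay_dominant Ii Oo A s \<longleftrightarrow> (\<forall>t. is_strategy Ii Oo t \<longrightarrow>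
     (\<forall>\<gamma>. word_over Ii \<gamma> \<longrightarrow> delay_dominates A s t \<gamma>))"

text \<open>Propositions of B: Inl v is the (unprimed) variable v in V_i, Inr o is the primed o' for o in O_i.\<close>

definition full_alph :: "'v set \<Rightarrow> 'v set \<Rightarrow> ('v + 'v) set" where
  "full_alph Ii Oo = Inl ` (Ii \<union> Oo) \<union> Inr ` Oo"

text \<open>iota = letter restricted to V_i; iota' = unpr(letter restricted to V_i').\<close>
definition letter_unpr :: "'v set \<Rightarrow> 'v set \<Rightarrow> ('v + 'v) set \<Rightarrow> 'v set" where
  "letter_unpr Ii Oo a = {v \<in> Ii \<union> Oo. Inl v \<in> a}"

definition letter_pr :: "'v set \<Rightarrow> 'v set \<Rightarrow> ('v + 'v) set \<Rightarrow> 'v set" where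
  "letter_pr Ii Oo a = {v \<in> Ii. Inl v \<in> a} \<union> {u \<in> Oo. Inr u \<in> a}"

text \<open>True = top, False = bot.\<close>
definition vartheta :: "'q set \<Rightarrow> 'q \<Rightarrow> 'q \<Rightarrow> bool \<Rightarrow> 'q \<times> 'q \<times> bool" where
  "vartheta F p q m =
     (if p \<notin> F \<and> q \<in> F \<and> m then (p, q, False)
      else if p \<notin> F \<and> \<not> m then (p, q, False)
      else (p, q, True))"

definition dnf_conj :: "'i set \<Rightarrow> ('i \<Rightarrow> 's set set) \<Rightarrow> 's set set" where
  "dnf_conj X D = {(\<Union>x \<in> X. f x) | f. \<forall>x \<in> X. f x \<in> D x}"

text \<open>DNF of  AND_{c in delta(p,iota')} OR_{c' in delta(q,iota)} AND_{q' in c'} OR_{p' in c} vartheta(p',q',m).\<close>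
definition bstep :: "('q, 'v) aca \<Rightarrow> 'q \<Rightarrow> 'q \<Rightarrow> bool \<Rightarrow> 'v set \<Rightarrow> 'v set
    \<Rightarrow> (('q \<times> 'q \<times> bool) + 'c) set set" where
  "bstep A p q m \<iota> \<iota>' =
     dnf_conj (aca_trans A p \<iota>') (\<lambda>c.
       \<Union>c' \<in> aca_trans A q \<iota>. dnf_conj c' (\<lambda>q'.
         \<Union>p' \<in> c. {{Inl (vartheta (aca_rej A) p' q' m)}}))"

definition constrB :: "'v set \<Rightarrow> 'v set \<Rightarrow> ('q, 'v) aca \<Rightarrow> ('c, 'v) aca
    \<Rightarrow> (('q \<times> 'q \<times> bool) + 'c, 'v + 'v) aca" where
  "constrB Ii Oo A C =
    \<lparr> aca_states = Inl ` (aca_states A \<times> aca_states A \<times> UNIV) \<union> Inr ` aca_states C,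
      aca_init = Inl (aca_init A, aca_init A, True),
      aca_trans = (\<lambda>st a. case st of
          Inr qc \<Rightarrow> (\<lambda>c. Inr ` c) ` aca_trans C qc (letter_pr Ii Oo a)
        | Inl (p, q, m) \<Rightarrow>
            (if (p, q, m) = (aca_init A, aca_init A, True)
             then (\<lambda>c. Inr ` c) ` aca_trans C (aca_init C) (letter_pr Ii Oo a)
                  \<union> bstep A p q m (letter_unpr Ii Oo a) (letter_pr Ii Oo a)
             else bstep A p q m (letter_unpr Ii Oo a) (letter_pr Ii Oo a))),
      aca_rej = Inl ` (aca_states A \<times> aca_states A \<times> {False}) \<union> Inr ` aca_rej C \<rparr>"

text \<open>A_dd = pi_{V_i}(B') for a UCA B' equivalent to B.\<close>
definition dd_uca :: "'v set \<Rightarrow> 'v set \<Rightarrow> ('b, 'v + 'v) uca \<Rightarrow> ('b, 'v + 'v) uca" where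
  "dd_uca Ii Oo B' = uca_proj (full_alph Ii Oo) (Inl ` (Ii \<union> Oo)) B'"

end

theory Submission
  imports Defs "HOL-Library.Countable_Set"
begin

text \<open>The delay-dominance game with Duplicator's pending obligation recorded in the flag is a Buechi
  game (the flag is infinitely often top), whereas the constructed automaton asks for a co-Buechi
  condition (the flag is finitely often bottom), or for an escape to the automaton of the negated
  formula. Everything is compared on positional winning regions, given by nested fixpoints.

  An escape at a later visit of the initial state is harmless: the remaining suffix of the
  alternative word is then rejected by the original automaton, so by determinacy Duplicator can
  drive the alternative state through rejecting states infinitely often.

  Conversely, let Duplicator win the Buechi game and let the alternative word be accepted.
  Duplicator then plays against an imaginary alternative run that is optimal for the following
  well-founded rank: a position gets rank (alpha, k) if from it one can enforce that after time k no
  rejecting state is visited before a position of rank below alpha is entered. The actual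
  alternative can be kept from dropping to a smaller alpha first, hence can be driven through a
  rejecting state after the last rejecting visit of the imaginary run, and the imaginary run
  visits rejecting states only finitely often. So the obligations are finitely many and all met.

  Finally, finite-state alternatives suffice because a rejecting run of the universal automaton in
  product with the Moore machine of the strategy contains a rejecting lasso.\<close>

section \<open>Stages of a least fixpoint, and Buechi and co-Buechi regions\<close>

text \<open>The transfinite iterates of \<open>f\<close> from the empty set, without ordinals.\<close>
inductive_set stages :: "('x set \<Rightarrow> 'x set) \<Rightarrow> 'x set set" for f where
  step: "X \<in> stages f \<Longrightarrow> f X \<in> stages f"
| Union: "(\<And>X. X \<in> M \<Longrightarrow> X \<in> stages f) \<Longrightarrow> \<Union>M \<in> stages f"

lemma stages_increasing:
  assumes "mono f" "X \<in> stages f"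
  shows "X \<subseteq> f X"
  using assms(2)
proof induction
  case (step X)
  then show ?case using monoD[OF assms(1)] by blast
next
  case (Union M)
  have "X \<subseteq> f (\<Union>M)" if "X \<in> M" for X
    using Union.IH[OF that] monoD[OF assms(1), of X "\<Union>M"] that by blast
  then show ?case by blast
qed

text \<open>Double induction in the style of the Bourbaki-Witt theorem. It makes the stages a chain
  in which nothing lies strictly between \<open>X\<close> and \<open>f X\<close>.\<close>

lemma stages_dichotomy:
  assumes f: "mono f" and "X \<in> stages f" and "Y \<in> stages f"
  shows "Y \<subseteq> X \<or> f X \<subseteq> Y"
  using assms(2,3)
proof (induction X arbitrary: Y)
  case (step X)
  note outer_IH = step.IH and X = step.hyps
  show ?case using step.prems
  proof induction
    case (step Y)
    show ?case
    proof (cases "Y \<subseteq> f X")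
      case True
      with outer_IH[OF step.hyps] show ?thesis
        using monoD[OF f, of Y X] by fastforce
    next
      case False
      then have "f (f X) \<subseteq> Y" using step.IH by blast
      then show ?thesis using stages_increasing[OF f step.hyps] by blast
    qed
  next
    case (Union M)
    then show ?case by blast
  qed
next
  case (Union M)
  note outer_IH = Union.IH and outer_hyps = Union.hyps
  show ?case using Union.prems
  proof induction
    case (step Y)
    show ?case
    proof (cases "f (\<Union>M) \<subseteq> Y")
      case True
      then show ?thesis using stages_increasing[OF f step.hyps] by blast
    next
      case False
      then have Y: "Y \<subseteq> \<Union>M" using step.IH by blast
      show ?thesis
      \<comment> \<open>If a member \<open>X\<close> contains \<open>Y\<close>, then either
        \<open>X\<close> is the whole union, or a member not below \<open>X\<close> contains
        \<open>f X\<close> and hence \<open>f Y\<close>. If no member contains \<open>Y\<close>, all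
        of them lie below \<open>Y\<close>.\<close>
      proof (cases "\<exists>X\<in>M. Y \<subseteq> X")
        case True
        then obtain X where X: "X \<in> M" "Y \<subseteq> X" by blast
        have fY: "f Y \<subseteq> f X" using monoD[OF f X(2)] .
        show ?thesis
        proof (cases "\<forall>X'\<in>M. X' \<subseteq> X")
          case True
          then have "\<Union>M = X" using X by blast
          then show ?thesis using outer_IH[OF X(1) stages.step[OF step.hyps]] by simp
        next
          case False
          then obtain X' where X': "X' \<in> M" "\<not> X' \<subseteq> X" by blast
          then have "f X \<subseteq> X'" using outer_IH[OF X(1) outer_hyps[OF X'(1)]] by blast
          then show ?thesis using fY X'(1) by blast
        qed
      next
        case False
        have "X \<subseteq> Y" if X: "X \<in> M" for X
          using outer_IH[OF X step.hyps] False X stages_increasing[OF f outer_hyps[OF X]] by blast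
        then have "Y = \<Union>M" using Y by blast
        then show ?thesis by blast
      qed
    qed
  next
    case (Union N)
    then show ?case by blast
  qed
qed

text \<open>The union of all stages is itself a stage, so \<open>f\<close> cannot enlarge it and it
  is a pre-fixpoint.\<close>

lemma Union_stages: "mono f \<Longrightarrow> \<Union>(stages f) = lfp f"
proof
  assume f: "mono f"
  have "X \<subseteq> lfp f" if "X \<in> stages f" for X using that
  proof induction
    case (step X)
    then show ?case using monoD[OF f, of X "lfp f"] lfp_unfold[OF f] by blast
  qed blast
  then show "\<Union>(stages f) \<subseteq> lfp f" by blast
  have "\<Union>(stages f) \<in> stages f" by (rule stages.Union)
  from stages.step[OF this] have "f (\<Union>(stages f)) \<subseteq> \<Union>(stages f)" by blast
  then show "lfp f \<subseteq> \<Union>(stages f)" by (rule lfp_lowerbound)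
qed

lemma lfp_in_stages: "mono f \<Longrightarrow> lfp f \<in> stages f"
  using Union_stages[of f] stages.Union[of "stages f" f] by metis

text \<open>For monotone \<open>f\<close> and \<open>x\<close> in \<open>lfp f\<close> this is the
  last stage before \<open>x\<close> enters; it stands in for the ordinal rank of
  \<open>x\<close>.\<close>

definition stage :: "('x set \<Rightarrow> 'x set) \<Rightarrow> 'x \<Rightarrow> 'x set" where
  "stage f x = \<Union>{X \<in> stages f. x \<notin> X}"

lemma stage_in_stages: "stage f x \<in> stages f"
  unfolding stage_def by (rule stages.Union) blast

text \<open>Otherwise \<open>f (stage f x)\<close> would be a stage without \<open>x\<close>, hence
  contained in \<open>stage f x\<close>, which would then be a pre-fixpoint above
  \<open>lfp f\<close>.\<close>

lemma stage_entry:
  assumes "mono f" "x \<in> lfp f"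
  shows "x \<in> f (stage f x)" "x \<notin> stage f x"
proof -
  show "x \<notin> stage f x" unfolding stage_def by blast
  show "x \<in> f (stage f x)"
  proof (rule ccontr)
    assume "x \<notin> f (stage f x)"
    then have "f (stage f x) \<subseteq> stage f x"
      using stages.step[OF stage_in_stages[of f x]] unfolding stage_def by blast
    then have "lfp f \<subseteq> stage f x" by (rule lfp_lowerbound)
    then show False using assms(2) \<open>x \<notin> stage f x\<close> by blast
  qed
qed

lemma stage_unique:
  assumes f: "mono f" and X: "X \<in> stages f" "x \<in> f X" "x \<notin> X"
  shows "stage f x = X"
proof
  show "X \<subseteq> stage f x" unfolding stage_def using X by blast
  show "stage f x \<subseteq> X"
    using stages_dichotomy[OF f X(1)] X(2) unfolding stage_def by blast
qed

text \<open>\<open>opts x\<close> lists the sets of successors to which the controlling player can confine the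
  next position.\<close>
definition force :: "('x \<Rightarrow> 'x set set) \<Rightarrow> 'x set \<Rightarrow> 'x set" where
  "force opts X = {x. \<exists>S \<in> opts x. S \<subseteq> X}"

text \<open>Staying outside \<open>F\<close> forever, or until \<open>X\<close> can be forced in one
  move; the position of that last move may lie in \<open>F\<close>. The least fixpoint over
  \<open>X\<close> is the mu-nu formula for finitely many visits to \<open>F\<close>;
  \<open>buchi\<close> below is the nu-mu formula for infinitely many visits to
  \<open>T\<close>.\<close>

definition cobuchi_step :: "('x \<Rightarrow> 'x set set) \<Rightarrow> 'x set \<Rightarrow> 'x set \<Rightarrow> 'x set" where
  "cobuchi_step opts F X = gfp (\<lambda>Y. (force opts Y - F) \<union> force opts X)"

definition cobuchi :: "('x \<Rightarrow> 'x set set) \<Rightarrow> 'x set \<Rightarrow> 'x set" where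
  "cobuchi opts F = lfp (cobuchi_step opts F)"

definition buchi_step :: "('x \<Rightarrow> 'x set set) \<Rightarrow> 'x set \<Rightarrow> 'x set \<Rightarrow> 'x set" where
  "buchi_step opts T Z = lfp (\<lambda>Y. (force opts Z \<inter> T) \<union> force opts Y)"

definition buchi :: "('x \<Rightarrow> 'x set set) \<Rightarrow> 'x set \<Rightarrow> 'x set" where
  "buchi opts T = gfp (buchi_step opts T)"

section \<open>Fixpoint laws and positional strategies for the two regions\<close>

lemma force_mono: "X \<subseteq> Y \<Longrightarrow> force opts X \<subseteq> force opts Y"
  unfolding force_def by blast

lemma mono_cobuchi_inner: "mono (\<lambda>Y. (force opts Y - F) \<union> force opts X)"
  by (rule monoI) (use force_mono in blast)

lemma mono_buchi_inner: "mono (\<lambda>Y. (force opts Z \<inter> T) \<union> force opts Y)"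
  by (rule monoI) (use force_mono in blast)

lemma cobuchi_step_unfold:
  "cobuchi_step opts F X = (force opts (cobuchi_step opts F X) - F) \<union> force opts X"
  unfolding cobuchi_step_def by (rule gfp_unfold[OF mono_cobuchi_inner])

lemma buchi_step_unfold:
  "buchi_step opts T Z = (force opts Z \<inter> T) \<union> force opts (buchi_step opts T Z)"
  unfolding buchi_step_def by (rule lfp_unfold[OF mono_buchi_inner])

lemma cobuchi_stepD:
  "x \<in> cobuchi_step opts F X \<Longrightarrow>
    x \<in> (force opts (cobuchi_step opts F X) - F) \<union> force opts X"
  by (subst (asm) cobuchi_step_unfold)

lemma buchi_stepI:
  "x \<in> (force opts Z \<inter> T) \<union> force opts (buchi_step opts T Z) \<Longrightarrow>
    x \<in> buchi_step opts T Z"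
  by (subst buchi_step_unfold)

lemma cobuchi_step_coinduct:
  assumes "S \<subseteq> (force opts (S \<union> cobuchi_step opts F X) - F) \<union> force opts X"
  shows "S \<subseteq> cobuchi_step opts F X"
  using assms unfolding cobuchi_step_def by (intro coinduct[OF mono_cobuchi_inner]) simp

lemma mono_cobuchi_step: "mono (cobuchi_step opts F)"
  unfolding cobuchi_step_def by (intro monoI gfp_mono) (use force_mono in blast)

lemma mono_buchi_step: "mono (buchi_step opts T)"
  unfolding buchi_step_def by (intro monoI lfp_mono) (use force_mono in blast)

lemma cobuchi_unfold: "cobuchi opts F = cobuchi_step opts F (cobuchi opts F)"
  unfolding cobuchi_def by (rule lfp_unfold[OF mono_cobuchi_step])

lemma buchi_unfold: "buchi opts T = buchi_step opts T (buchi opts T)"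
  unfolding buchi_def by (rule gfp_unfold[OF mono_buchi_step])

lemma force_cobuchi: "force opts (cobuchi opts F) \<subseteq> cobuchi opts F"
  using cobuchi_step_unfold[of opts F "cobuchi opts F"] unfolding cobuchi_unfold[symmetric] by blast

lemma cobuchi_force: "cobuchi opts F \<subseteq> force opts (cobuchi opts F)"
  using cobuchi_step_unfold[of opts F "cobuchi opts F"] unfolding cobuchi_unfold[symmetric] by blast

lemma buchi_force: "buchi opts T \<subseteq> force opts (buchi opts T)"
  using buchi_step_unfold[of opts T "buchi opts T"] unfolding buchi_unfold[symmetric] by blast

lemma force_buchi: "force opts (buchi opts T) \<subseteq> buchi opts T"
  using buchi_step_unfold[of opts T "buchi opts T"] unfolding buchi_unfold[symmetric] by blast

text \<open>The option at \<open>x\<close> is read off the unfolding at the stage of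
  \<open>x\<close>. Along a path the stage never grows, and it shrinks strictly after each visit to
  \<open>F\<close>; induction on stages does the work of well-foundedness.\<close>

lemma cobuchi_strategy:
  obtains N where "\<And>x. x \<in> cobuchi opts F \<Longrightarrow> N x \<in> opts x"
    and "\<And>\<rho>. \<lbrakk>\<rho> 0 \<in> cobuchi opts F; \<And>i. \<rho> (Suc i) \<in> N (\<rho> i)\<rbrakk> \<Longrightarrow> \<exists>n. \<forall>i\<ge>n. \<rho> i \<notin> F"
    and "\<And>x. x \<in> cobuchi opts F \<Longrightarrow> N x \<subseteq> cobuchi opts F"
proof -
  let ?f = "cobuchi_step opts F"
  note f = mono_cobuchi_step[of opts F]
  have "\<exists>S\<in>opts x. S \<subseteq> ?f (stage ?f x) \<and> (x \<in> F \<longrightarrow> S \<subseteq> stage ?f x)"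
    if "x \<in> cobuchi opts F" for x
  proof -
    have "x \<in> ?f (stage ?f x)" using stage_entry(1)[OF f] that unfolding cobuchi_def by blast
    from cobuchi_stepD[OF this] show ?thesis
      using stages_increasing[OF f stage_in_stages[of ?f x]] unfolding force_def by blast
  qed
  then obtain N where N: "\<And>x. x \<in> cobuchi opts F \<Longrightarrow>
      N x \<in> opts x \<and> N x \<subseteq> ?f (stage ?f x) \<and> (x \<in> F \<longrightarrow> N x \<subseteq> stage ?f x)"
    by metis
  have sub: "X \<subseteq> cobuchi opts F" if "X \<in> stages ?f" for X
    using that Union_stages[OF f] unfolding cobuchi_def by blast
  have paths: "\<exists>n. \<forall>i\<ge>n. \<rho> i \<notin> F"
    if "X \<in> stages ?f" "\<rho> 0 \<in> X" "\<And>i. \<rho> (Suc i) \<in> N (\<rho> i)" for X \<rho>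
    using that
  proof (induction arbitrary: \<rho>)
    case (step X)
    show ?case
    proof (cases "\<exists>i. \<rho> i \<in> X")
      case True
      then obtain k where "\<rho> k \<in> X" by blast
      then have "\<exists>n. \<forall>i\<ge>n. \<rho> (k + i) \<notin> F"
        using step.IH[of "\<lambda>i. \<rho> (k + i)"] step.prems by simp
      then obtain n where "\<forall>i\<ge>n. \<rho> (k + i) \<notin> F" by blast
      then show ?thesis by (metis add_leD1 le_Suc_ex add_le_cancel_left)
    next
      case False
      \<comment> \<open>A path that never meets \<open>X\<close> keeps the stage \<open>X\<close>
        forever, so a visit to \<open>F\<close> would send it into \<open>X\<close>.\<close>
      have inX: "\<rho> i \<in> ?f X" for i
      proof (induction i)
        case 0
        show ?case by (fact step.prems(1))
      next
        case (Suc i)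
        then have "stage ?f (\<rho> i) = X" using stage_unique[OF f step.hyps] False by blast
        moreover have "\<rho> i \<in> cobuchi opts F" using Suc sub[OF stages.step[OF step.hyps]] by blast
        ultimately show ?case using N step.prems(2)[of i] by blast
      qed
      have "\<rho> i \<notin> F" for i
      proof
        assume F: "\<rho> i \<in> F"
        have "stage ?f (\<rho> i) = X" using stage_unique[OF f step.hyps inX] False by blast
        moreover have "\<rho> i \<in> cobuchi opts F" using inX sub[OF stages.step[OF step.hyps]] by blast
        ultimately show False using N F step.prems(2)[of i] False by blast
      qed
      then show ?thesis by blast
    qed
  next
    case (Union M)
    then show ?case by blast
  qed
  show thesis
  proof (rule that)
    show "\<exists>n. \<forall>i\<ge>n. \<rho> i \<notin> F"
      if "\<rho> 0 \<in> cobuchi opts F" "\<And>i. \<rho> (Suc i) \<in> N (\<rho> i)" for \<rho>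
      using paths[OF lfp_in_stages[OF f]] that unfolding cobuchi_def by blast
    show "N x \<subseteq> cobuchi opts F" if "x \<in> cobuchi opts F" for x
      using N[OF that] sub[OF stages.step[OF stage_in_stages]] by blast
  qed (use N in blast)
qed

text \<open>Here the rank is the stage of the inner least fixpoint, taken at the outer fixpoint.
  Outside \<open>T\<close> every move lowers it; from \<open>T\<close> the path only has to stay in
  the region. Applied to tails of the path, this gives arbitrarily late visits.\<close>

lemma buchi_strategy:
  obtains N where "\<And>x. x \<in> buchi opts T \<Longrightarrow> N x \<in> opts x"
    and "\<And>\<rho> n. \<lbrakk>\<rho> 0 \<in> buchi opts T; \<And>i. \<rho> (Suc i) \<in> N (\<rho> i)\<rbrakk> \<Longrightarrow> \<exists>i\<ge>n. \<rho> i \<in> T"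
    and "\<And>x. x \<in> buchi opts T \<Longrightarrow> N x \<subseteq> buchi opts T"
proof -
  let ?Z = "buchi opts T"
  let ?g = "\<lambda>Y. (force opts ?Z \<inter> T) \<union> force opts Y"
  note g = mono_buchi_inner[of opts ?Z T]
  have Z: "?Z = lfp ?g" using buchi_unfold[of opts T] unfolding buchi_step_def .
  have sub: "X \<subseteq> ?Z" if "X \<in> stages ?g" for X
    using that Union_stages[OF g] Z by blast
  have "\<exists>S\<in>opts x. S \<subseteq> ?Z \<and> (x \<notin> T \<longrightarrow> S \<subseteq> stage ?g x)" if "x \<in> ?Z" for x
  proof -
    have "x \<in> ?g (stage ?g x)" using stage_entry(1)[OF g] that Z by blast
    then show ?thesis
      using sub[OF stage_in_stages[of ?g x]] unfolding force_def by blast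
  qed
  then obtain N where N: "\<And>x. x \<in> ?Z \<Longrightarrow>
      N x \<in> opts x \<and> N x \<subseteq> ?Z \<and> (x \<notin> T \<longrightarrow> N x \<subseteq> stage ?g x)"
    by metis
  have paths: "\<exists>i. \<rho> i \<in> T"
    if "X \<in> stages ?g" "\<rho> 0 \<in> X" "\<And>i. \<rho> (Suc i) \<in> N (\<rho> i)" for X \<rho>
    using that
  proof (induction arbitrary: \<rho>)
    case (step X)
    show ?case
    proof (cases "\<rho> 0 \<in> X \<or> \<rho> 0 \<in> T")
      case True
      then show ?thesis using step.IH step.prems(2) by blast
    next
      case False
      then have "stage ?g (\<rho> 0) = X" using stage_unique[OF g step.hyps step.prems(1)] by blast
      moreover have "\<rho> 0 \<in> ?Z" using step.prems(1) sub[OF stages.step[OF step.hyps]] by blast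
      ultimately have "\<rho> (Suc 0) \<in> X" using N step.prems(2)[of 0] False by blast
      then show ?thesis using step.IH[of "\<lambda>i. \<rho> (Suc i)"] step.prems(2) by blast
    qed
  next
    case (Union M)
    then show ?case by blast
  qed
  show thesis
  proof (rule that)
    show "\<exists>i\<ge>n. \<rho> i \<in> T"
      if r: "\<rho> 0 \<in> ?Z" "\<And>i. \<rho> (Suc i) \<in> N (\<rho> i)" for \<rho> n
    proof -
      have "\<rho> i \<in> ?Z" for i
        by (induction i) (use r N in blast)+
      then have "\<rho> (n + 0) \<in> lfp ?g" using Z by simp
      then have "\<exists>i. \<rho> (n + i) \<in> T"
        using paths[OF lfp_in_stages[OF g], of "\<lambda>i. \<rho> (n + i)"] r(2) by simp
      then show ?thesis using le_add1 by blast
    qed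
  qed (use N in blast)+
qed

text \<open>The opponent confines the next position to \<open>S\<close> iff \<open>S\<close> meets every option of the player.\<close>
definition dual :: "('x \<Rightarrow> 'x set set) \<Rightarrow> 'x \<Rightarrow> 'x set set" where
  "dual opts x = {S. \<forall>S' \<in> opts x. S \<inter> S' \<noteq> {}}"

section \<open>Determinacy, and strategies with memory\<close>

lemma force_dual: "force (dual opts) X = - force opts (- X)"
  unfolding force_def dual_def by (auto simp: disjoint_eq_subset_Compl)

text \<open>By duality \<open>- ?Y\<close> is a post-fixpoint of the inner co-Buechi operator, so it
  lies in \<open>?W\<close>. Hence \<open>- ?W\<close> is contained in its own Buechi step for the
  opponent, and coinduction applies.\<close>

lemma not_cobuchi: "- cobuchi opts F \<subseteq> buchi (dual opts) F"
proof -
  let ?W = "cobuchi opts F"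
  let ?Y = "buchi_step (dual opts) F (- ?W)"
  have "x \<in> (force opts (- ?Y) - F) \<union> force opts ?W" if "x \<notin> ?Y" for x
  proof -
    have "x \<notin> (force (dual opts) (- ?W) \<inter> F) \<union> force (dual opts) ?Y"
      using that buchi_stepI by metis
    then show ?thesis by (auto simp: force_dual)
  qed
  then have "- ?Y \<subseteq> cobuchi_step opts F ?W"
    by (intro cobuchi_step_coinduct) (use force_mono[of "- ?Y" "- ?Y \<union> cobuchi_step opts F ?W" opts] in blast)
  then have "- ?W \<subseteq> ?Y" unfolding cobuchi_unfold[symmetric] by blast
  then show ?thesis unfolding buchi_def by (rule gfp_upperbound)
qed

lemma not_buchi: "- buchi opts T \<subseteq> cobuchi (dual opts) T"
proof -
  let ?K = "cobuchi (dual opts) T"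
  let ?Y = "buchi_step opts T (- ?K)"
  have "x \<in> (force (dual opts) (- ?Y) - T) \<union> force (dual opts) ?K" if "x \<notin> ?Y" for x
  proof -
    have "x \<notin> (force opts (- ?K) \<inter> T) \<union> force opts ?Y"
      using that buchi_stepI by metis
    then show ?thesis by (auto simp: force_dual)
  qed
  then have "- ?Y \<subseteq> cobuchi_step (dual opts) T ?K"
    by (intro cobuchi_step_coinduct)
      (use force_mono[of "- ?Y" "- ?Y \<union> cobuchi_step (dual opts) T ?K" "dual opts"] in blast)
  then have "- ?K \<subseteq> ?Y" unfolding cobuchi_unfold[symmetric] by blast
  then have "- ?K \<subseteq> buchi opts T" unfolding buchi_def by (rule gfp_upperbound)
  then show ?thesis by blast
qed

text \<open>\<open>H\<close> consists of histories, so the player may use memory. The option taken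
  in the tree meets the opponent's positional choice at every node, and following common successors
  yields one branch that obeys both.\<close>

lemma tree_meets_dual_strategy:
  assumes tree: "\<And>h. h \<in> H \<Longrightarrow> lab ` (succ h \<inter> H) \<in> opts (lab h)"
    and "h0 \<in> H" and "lab h0 \<in> W"
    and N: "\<And>x. x \<in> W \<Longrightarrow> N x \<in> dual opts x" "\<And>x. x \<in> W \<Longrightarrow> N x \<subseteq> W"
  obtains \<beta> where "\<beta> 0 = h0" and "\<And>i. \<beta> i \<in> H" and "\<And>i. \<beta> (Suc i) \<in> succ (\<beta> i)"
    and "\<And>i. lab (\<beta> (Suc i)) \<in> N (lab (\<beta> i))"
proof -
  have ex: "\<exists>h'. (h' \<in> H \<and> lab h' \<in> W) \<and> h' \<in> succ h \<and> lab h' \<in> N (lab h)"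
    if h: "h \<in> H" "lab h \<in> W" for h
  proof -
    have "N (lab h) \<inter> lab ` (succ h \<inter> H) \<noteq> {}"
      using N(1)[OF h(2)] tree[OF h(1)] unfolding dual_def by simp
    then obtain h' where "h' \<in> succ h" "h' \<in> H" "lab h' \<in> N (lab h)" by auto
    then show ?thesis using N(2)[OF h(2)] by auto
  qed
  \<comment> \<open>The clause for \<open>i = 0\<close> pins the branch to the root
    \<open>h0\<close>.\<close>
  define P where "P i h \<longleftrightarrow> h \<in> H \<and> lab h \<in> W \<and> (i = 0 \<longrightarrow> h = h0)" for i :: nat and h
  have "\<exists>\<beta>. \<forall>i. P i (\<beta> i) \<and> (\<beta> (Suc i) \<in> succ (\<beta> i) \<and> lab (\<beta> (Suc i)) \<in> N (lab (\<beta> i)))"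
  proof (rule dependent_nat_choice)
    show "\<exists>h. P 0 h" using assms(2,3) unfolding P_def by blast
    show "\<exists>h'. P (Suc i) h' \<and> (h' \<in> succ h \<and> lab h' \<in> N (lab h))" if "P i h" for h i
      using ex[of h] that unfolding P_def by auto
  qed
  then obtain \<beta> where "\<And>i. P i (\<beta> i)" "\<And>i. \<beta> (Suc i) \<in> succ (\<beta> i)"
      "\<And>i. lab (\<beta> (Suc i)) \<in> N (lab (\<beta> i))"
    by auto
  then show thesis using that[of \<beta>] unfolding P_def by simp
qed

text \<open>Memory gives no advantage: outside the region determinacy provides a positional
  counterstrategy, and the branch obeying both would visit \<open>F\<close> finitely and infinitely
  often.\<close>

lemma cobuchi_tree:
  assumes tree: "\<And>h. h \<in> H \<Longrightarrow> lab ` (succ h \<inter> H) \<in> opts (lab h)" and h0: "h0 \<in> H"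
    and paths: "\<And>\<beta>. \<lbrakk>\<beta> 0 = h0; \<And>i. \<beta> i \<in> H; \<And>i. \<beta> (Suc i) \<in> succ (\<beta> i)\<rbrakk>
      \<Longrightarrow> \<exists>n. \<forall>i\<ge>n. lab (\<beta> i) \<notin> F"
  shows "lab h0 \<in> cobuchi opts F"
proof (rule ccontr)
  assume "lab h0 \<notin> cobuchi opts F"
  then have W: "lab h0 \<in> buchi (dual opts) F" using not_cobuchi[of opts F] by blast
  obtain N where N: "\<And>x. x \<in> buchi (dual opts) F \<Longrightarrow> N x \<in> dual opts x"
    and inf: "\<And>\<rho> n. \<lbrakk>\<rho> 0 \<in> buchi (dual opts) F; \<And>i. \<rho> (Suc i) \<in> N (\<rho> i)\<rbrakk> \<Longrightarrow> \<exists>i\<ge>n. \<rho> i \<in> F"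
    and NW: "\<And>x. x \<in> buchi (dual opts) F \<Longrightarrow> N x \<subseteq> buchi (dual opts) F"
    using buchi_strategy by metis
  obtain \<beta> where b: "\<beta> 0 = h0" "\<And>i. \<beta> i \<in> H" "\<And>i. \<beta> (Suc i) \<in> succ (\<beta> i)"
    "\<And>i. lab (\<beta> (Suc i)) \<in> N (lab (\<beta> i))"
    using tree_meets_dual_strategy[OF tree h0 W N NW] by metis
  obtain n where "\<forall>i\<ge>n. lab (\<beta> i) \<notin> F" using paths[OF b(1-3)] by blast
  moreover have "\<exists>i\<ge>n. lab (\<beta> i) \<in> F" using inf[of "\<lambda>i. lab (\<beta> i)" n] b W by simp
  ultimately show False by blast
qed

lemma buchi_tree:
  assumes tree: "\<And>h. h \<in> H \<Longrightarrow> lab ` (succ h \<inter> H) \<in> opts (lab h)" and h0: "h0 \<in> H"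
    and paths: "\<And>\<beta> n. \<lbrakk>\<beta> 0 = h0; \<And>i. \<beta> i \<in> H; \<And>i. \<beta> (Suc i) \<in> succ (\<beta> i)\<rbrakk>
      \<Longrightarrow> \<exists>i\<ge>n. lab (\<beta> i) \<in> T"
  shows "lab h0 \<in> buchi opts T"
proof (rule ccontr)
  assume "lab h0 \<notin> buchi opts T"
  then have W: "lab h0 \<in> cobuchi (dual opts) T" using not_buchi[of opts T] by blast
  obtain N where N: "\<And>x. x \<in> cobuchi (dual opts) T \<Longrightarrow> N x \<in> dual opts x"
    and fin: "\<And>\<rho>. \<lbrakk>\<rho> 0 \<in> cobuchi (dual opts) T; \<And>i. \<rho> (Suc i) \<in> N (\<rho> i)\<rbrakk> \<Longrightarrow> \<exists>n. \<forall>i\<ge>n. \<rho> i \<notin> T"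
    and NW: "\<And>x. x \<in> cobuchi (dual opts) T \<Longrightarrow> N x \<subseteq> cobuchi (dual opts) T"
    using cobuchi_strategy by metis
  obtain \<beta> where b: "\<beta> 0 = h0" "\<And>i. \<beta> i \<in> H" "\<And>i. \<beta> (Suc i) \<in> succ (\<beta> i)"
    "\<And>i. lab (\<beta> (Suc i)) \<in> N (lab (\<beta> i))"
    using tree_meets_dual_strategy[OF tree h0 W N NW] by metis
  obtain n where "\<forall>i\<ge>n. lab (\<beta> i) \<notin> T" using fin[of "\<lambda>i. lab (\<beta> i)"] b W by auto
  moreover have "\<exists>i\<ge>n. lab (\<beta> i) \<in> T" using paths[OF b(1-3)] by blast
  ultimately show False by blast
qed

section \<open>Transfer of co-Buechi regions along a map of positions\<close>

lemma cobuchi_vimage_subset: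
  assumes "\<And>X. h -` force opts X \<subseteq> force opts' (h -` X)" and "F' \<subseteq> h -` F"
  shows "h -` cobuchi opts F \<subseteq> cobuchi opts' F'"
proof -
  \<comment> \<open>The largest set whose \<open>h\<close>-preimage lies in the target region. It is
    shown to be a pre-fixpoint, so it bounds \<open>cobuchi opts F\<close>.\<close>
  let ?X = "- (h ` (- cobuchi opts' F'))"
  let ?G = "cobuchi_step opts F ?X"
  have X: "h -` ?X \<subseteq> cobuchi opts' F'" by blast
  have "h -` ?G \<subseteq> (force opts' (h -` ?G) - F') \<union> force opts' (cobuchi opts' F')"
  proof
    fix y assume "y \<in> h -` ?G"
    then have "h y \<in> (force opts ?G - F) \<union> force opts ?X" by (intro cobuchi_stepD) simp
    then show "y \<in> (force opts' (h -` ?G) - F') \<union> force opts' (cobuchi opts' F')"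
      using assms(1)[of ?G] assms(1)[of ?X] assms(2) force_mono[OF X, of opts'] by blast
  qed
  then have "h -` ?G \<subseteq> cobuchi_step opts' F' (cobuchi opts' F')"
    by (intro cobuchi_step_coinduct)
      (use force_mono[of "h -` ?G" "h -` ?G \<union> cobuchi_step opts' F' (cobuchi opts' F')" opts'] in blast)
  then have "?G \<subseteq> ?X" unfolding cobuchi_unfold[of opts' F', symmetric] by blast
  then have "cobuchi opts F \<subseteq> ?X" unfolding cobuchi_def[of opts F] by (rule lfp_lowerbound)
  then show ?thesis by blast
qed

lemma cobuchi_subset_vimage:
  assumes "\<And>X. force opts' (h -` X) \<subseteq> h -` force opts X" and "h -` F \<subseteq> F'"
  shows "cobuchi opts' F' \<subseteq> h -` cobuchi opts F"
proof -
  let ?X = "h -` cobuchi opts F"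
  let ?G = "cobuchi_step opts' F' ?X"
  have G: "?G \<subseteq> h -` (h ` ?G)" by blast
  have "h y \<in> (force opts (h ` ?G) - F) \<union> force opts (cobuchi opts F)" if "y \<in> ?G" for y
  proof -
    have "y \<in> (force opts' ?G - F') \<union> force opts' ?X" using that by (rule cobuchi_stepD)
    then show ?thesis
      using assms(1)[of "h ` ?G"] assms(1)[of "cobuchi opts F"] assms(2) force_mono[OF G, of opts']
      by blast
  qed
  then have "h ` ?G \<subseteq> cobuchi_step opts F (cobuchi opts F)"
    by (intro cobuchi_step_coinduct)
      (use force_mono[of "h ` ?G" "h ` ?G \<union> cobuchi_step opts F (cobuchi opts F)" opts] in blast)
  then have "?G \<subseteq> ?X" unfolding cobuchi_unfold[of opts F, symmetric] by blast
  then show ?thesis unfolding cobuchi_def[of opts' F'] by (rule lfp_lowerbound)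
qed

section \<open>Acceptance of alternating automata as a co-Buechi region\<close>

text \<open>Time belongs to the position because the available disjuncts depend on the letter read
  there.\<close>

definition aca_opts :: "('q, 'v) aca \<Rightarrow> 'v word \<Rightarrow> 'q \<times> nat \<Rightarrow> ('q \<times> nat) set set" where
  "aca_opts M w = (\<lambda>(q, j). (\<lambda>c. c \<times> {Suc j}) ` aca_trans M q (w j))"

definition aca_win :: "('q, 'v) aca \<Rightarrow> 'v word \<Rightarrow> ('q \<times> nat) set" where
  "aca_win M w = cobuchi (aca_opts M w) (aca_rej M \<times> UNIV)"

text \<open>Well-formedness localised to the letters of one word. Finiteness of the disjuncts is
  what later bounds and chain arguments over successors rest on.\<close>

definition finitely_branching :: "('q, 'v) aca \<Rightarrow> 'v word \<Rightarrow> bool" where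
  "finitely_branching M w \<longleftrightarrow> aca_init M \<in> aca_states M \<and>
     (\<forall>q \<in> aca_states M. \<forall>j. aca_trans M q (w j) \<noteq> {} \<and>
        (\<forall>c \<in> aca_trans M q (w j). c \<noteq> {} \<and> finite c \<and> c \<subseteq> aca_states M))"

lemma finitely_branching_wf:
  assumes wf: "aca_wf \<Sigma> M" and w: "word_over \<Sigma> w"
  shows "finitely_branching M w"
proof -
  have "aca_trans M q (w j) \<noteq> {} \<and>
      (\<forall>c \<in> aca_trans M q (w j). c \<noteq> {} \<and> finite c \<and> c \<subseteq> aca_states M)"
    if "q \<in> aca_states M" for q j
  proof -
    have "w j \<subseteq> \<Sigma>" using w unfolding word_over_def by simp
    then have "aca_trans M q (w j) \<noteq> {}"
        "\<And>c. c \<in> aca_trans M q (w j) \<Longrightarrow> c \<noteq> {} \<and> c \<subseteq> aca_states M"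
      using wf that unfolding aca_wf_def by simp_all
    moreover have "finite (aca_states M)" using wf unfolding aca_wf_def by simp
    ultimately show ?thesis using finite_subset by metis
  qed
  then show ?thesis using wf unfolding aca_wf_def finitely_branching_def by simp
qed

lemma force_aca:
  "(q, j) \<in> force (aca_opts M w) X \<longleftrightarrow> (\<exists>c \<in> aca_trans M q (w j). \<forall>q' \<in> c. (q', Suc j) \<in> X)"
  unfolding force_def aca_opts_def by auto

lemma force_dual_aca:
  "(q, j) \<in> force (dual (aca_opts M w)) X \<longleftrightarrow>
    (\<forall>c \<in> aca_trans M q (w j). \<exists>q' \<in> c. (q', Suc j) \<in> X)"
  by (auto simp: force_dual force_aca)

text \<open>The run tree itself serves as the tree of histories in \<open>cobuchi_tree\<close>, with
  the depth of a node as its time.\<close>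

lemma aca_accepts_win:
  assumes "aca_accepts M w"
  shows "(aca_init M, 0) \<in> aca_win M w"
proof -
  obtain T l where run: "aca_run_tree M w T l" and acc: "aca_run_accepting M T l"
    using assms unfolding aca_accepts_def by blast
  let ?lab = "\<lambda>x. (l x, length x)" and ?succ = "\<lambda>x. {x @ [n] | n. True}"
  have "?lab [] \<in> cobuchi (aca_opts M w) (aca_rej M \<times> UNIV)"
  proof (rule cobuchi_tree[where lab = ?lab and succ = ?succ and H = T])
    show "[] \<in> T" using run unfolding aca_run_tree_def by blast
    show "?lab ` (?succ x \<inter> T) \<in> aca_opts M w (?lab x)" if "x \<in> T" for x
    proof -
      let ?c = "{l (x @ [n]) | n. x @ [n] \<in> T}"
      have "?lab ` (?succ x \<inter> T) = ?c \<times> {Suc (length x)}" by force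
      moreover have "?c \<in> aca_trans M (l x) (w (length x))"
        using run that unfolding aca_run_tree_def by blast
      ultimately show ?thesis unfolding aca_opts_def by auto
    qed
    show "\<exists>n. \<forall>i\<ge>n. ?lab (\<beta> i) \<notin> aca_rej M \<times> UNIV"
      if "\<beta> 0 = []" "\<And>i. \<beta> i \<in> T" "\<And>i. \<beta> (Suc i) \<in> ?succ (\<beta> i)" for \<beta>
    proof -
      have "tree_branch T \<beta>" using that unfolding tree_branch_def by blast
      then have "finite {k. l (\<beta> k) \<in> aca_rej M}"
        using acc unfolding aca_run_accepting_def by blast
      then obtain n where "\<And>k. l (\<beta> k) \<in> aca_rej M \<Longrightarrow> k < n"
        unfolding finite_nat_set_iff_bounded by blast
      then show ?thesis by (metis SigmaD1 leD)
    qed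
  qed
  moreover have "l [] = aca_init M" using run unfolding aca_run_tree_def by blast
  ultimately show ?thesis unfolding aca_win_def by simp
qed

text \<open>A positional strategy is unravelled into a run tree. The offset \<open>j\<close> covers
  suffixes, as required when the constructed automaton escapes at a later visit to its initial
  state.\<close>

lemma aca_win_accepts:
  assumes win: "(aca_init M, j) \<in> aca_win M w" and fb: "finitely_branching M w"
  shows "aca_accepts M (\<lambda>k. w (k + j))"
proof -
  obtain N where N: "\<And>x. x \<in> aca_win M w \<Longrightarrow> N x \<in> aca_opts M w x"
    and fin: "\<And>\<rho>. \<lbrakk>\<rho> 0 \<in> aca_win M w; \<And>i. \<rho> (Suc i) \<in> N (\<rho> i)\<rbrakk>
      \<Longrightarrow> \<exists>n. \<forall>i\<ge>n. \<rho> i \<notin> aca_rej M \<times> UNIV"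
    and NW: "\<And>x. x \<in> aca_win M w \<Longrightarrow> N x \<subseteq> aca_win M w"
    unfolding aca_win_def using cobuchi_strategy by metis
  have "\<exists>c \<in> aca_trans M q (w i). N (q, i) = c \<times> {Suc i}" if "(q, i) \<in> aca_win M w" for q i
    using N[OF that] unfolding aca_opts_def by auto
  then obtain C where C: "\<And>q i. (q, i) \<in> aca_win M w \<Longrightarrow> C q i \<in> aca_trans M q (w i)"
    and NC: "\<And>q i. (q, i) \<in> aca_win M w \<Longrightarrow> N (q, i) = C q i \<times> {Suc i}"
    by metis
  \<comment> \<open>Child \<open>n\<close> carries the \<open>n\<close>-th element of the chosen
    disjunct. \<open>from_nat_into\<close> repeats elements of a finite set, so the full tree of all
    number lists realises exactly that disjunct.\<close>
  define pos where
    "pos = foldl (\<lambda>(q, i) n. (from_nat_into (C q i) n, Suc i)) (aca_init M, j)"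
  have pos_Nil: "pos [] = (aca_init M, j)" unfolding pos_def by simp
  have pos_snoc: "pos (x @ [n]) = (from_nat_into (C q i) n, Suc i)" if "pos x = (q, i)" for x n q i
    using that unfolding pos_def by simp
  have inv: "\<exists>q. pos x = (q, j + length x) \<and> (q, j + length x) \<in> aca_win M w \<and> q \<in> aca_states M" for x
  proof (induction x rule: rev_induct)
    case Nil
    then show ?case using win fb by (simp add: pos_Nil finitely_branching_def)
  next
    case (snoc n x)
    let ?i = "j + length x"
    obtain q where q: "pos x = (q, ?i)" "(q, ?i) \<in> aca_win M w" "q \<in> aca_states M"
      using snoc by blast
    have c: "C q ?i \<noteq> {}" "C q ?i \<subseteq> aca_states M"
      using C[OF q(2)] fb q(3) unfolding finitely_branching_def by blast+
    have "from_nat_into (C q ?i) n \<in> C q ?i" using c(1) by (rule from_nat_into)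
    then show ?case
      using c(2) NW[OF q(2)] unfolding NC[OF q(2)] by (auto simp: pos_snoc[OF q(1)])
  qed
  have step: "pos (x @ [n]) \<in> N (pos x)"
    and trans: "range (\<lambda>n. fst (pos (x @ [n]))) \<in> aca_trans M (fst (pos x)) (w (length x + j))" for x n
  proof -
    let ?i = "j + length x"
    obtain q where q: "pos x = (q, ?i)" "(q, ?i) \<in> aca_win M w" "q \<in> aca_states M"
      using inv by blast
    have ne: "C q ?i \<noteq> {}" and "finite (C q ?i)"
      using C[OF q(2)] fb q(3) unfolding finitely_branching_def by blast+
    then have "range (\<lambda>n. fst (pos (x @ [n]))) = C q ?i"
      using range_from_nat_into[OF ne] by (simp add: pos_snoc[OF q(1)] countable_finite)
    then show "range (\<lambda>n. fst (pos (x @ [n]))) \<in> aca_trans M (fst (pos x)) (w (length x + j))"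
      using C[OF q(2)] q(1) by (simp add: add.commute)
    have "from_nat_into (C q ?i) n \<in> C q ?i" using ne by (rule from_nat_into)
    then show "pos (x @ [n]) \<in> N (pos x)"
      unfolding q(1) NC[OF q(2)] pos_snoc[OF q(1)] by simp
  qed
  have "aca_run_tree M (\<lambda>k. w (k + j)) UNIV (\<lambda>x. fst (pos x))"
    unfolding aca_run_tree_def
  proof (intro conjI ballI)
    fix x
    show "{fst (pos (x @ [n])) | n. x @ [n] \<in> UNIV}
        \<in> aca_trans M (fst (pos x)) (w (length x + j))"
      using trans[of x] by (simp add: full_SetCompr_eq)
  qed (simp_all add: pos_Nil)
  moreover have "aca_run_accepting M UNIV (\<lambda>x. fst (pos x))"
    unfolding aca_run_accepting_def
  proof (intro allI impI)
    fix \<beta> assume "tree_branch UNIV \<beta>"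
    then have b: "\<beta> 0 = []" "\<And>k. \<exists>n. \<beta> (Suc k) = \<beta> k @ [n]"
      unfolding tree_branch_def by auto
    have "pos (\<beta> (Suc i)) \<in> N (pos (\<beta> i))" for i using b(2)[of i] step by auto
    then obtain n where n: "\<forall>i\<ge>n. pos (\<beta> i) \<notin> aca_rej M \<times> UNIV"
      using fin[of "\<lambda>i. pos (\<beta> i)"] win by (auto simp: b(1) pos_Nil)
    have "{k. fst (pos (\<beta> k)) \<in> aca_rej M} \<subseteq> {..<n}"
    proof
      fix k assume "k \<in> {k. fst (pos (\<beta> k)) \<in> aca_rej M}"
      then have "pos (\<beta> k) \<in> aca_rej M \<times> UNIV" by (simp add: mem_Times_iff)
      then have "\<not> n \<le> k" using n by meson
      then show "k \<in> {..<n}" by simp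
    qed
    then show "finite {k. fst (pos (\<beta> k)) \<in> aca_rej M}" using finite_subset by blast
  qed
  ultimately show ?thesis unfolding aca_accepts_def by blast
qed

section \<open>From delay-dominance to finitely many pending moments\<close>

text \<open>Bottom means that a visit of the dominant state to \<open>F\<close> is still unanswered;
  a visit of the alternative state answers it at once.\<close>

lemma vartheta_eq: "vartheta F p q m = (p, q, p \<in> F \<or> m \<and> q \<notin> F)"
  unfolding vartheta_def by auto

text \<open>One full round of the delay-dominance game: the first components of a position are those
  of the states of the constructed automaton, the last one is the time.\<close>
definition game_opts :: "('q, 'v) aca \<Rightarrow> 'v word \<Rightarrow> 'v word \<Rightarrow>
    ('q \<times> 'q \<times> bool) \<times> nat \<Rightarrow> (('q \<times> 'q \<times> bool) \<times> nat) set set" where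
  "game_opts A u v = (\<lambda>((p, q, m), j).
     {S. \<forall>c \<in> aca_trans A p (u j). \<exists>c' \<in> aca_trans A q (v j). \<forall>q' \<in> c'. \<exists>p' \<in> c.
        (vartheta (aca_rej A) p' q' m, Suc j) \<in> S})"

lemma force_game:
  "((p, q, m), j) \<in> force (game_opts A u v) X \<longleftrightarrow>
     (\<forall>c \<in> aca_trans A p (u j). \<exists>c' \<in> aca_trans A q (v j). \<forall>q' \<in> c'. \<exists>p' \<in> c.
        (vartheta (aca_rej A) p' q' m, Suc j) \<in> X)"
proof
  assume "((p, q, m), j) \<in> force (game_opts A u v) X"
  then obtain S where S: "S \<subseteq> X" "\<forall>c \<in> aca_trans A p (u j). \<exists>c' \<in> aca_trans A q (v j).
      \<forall>q' \<in> c'. \<exists>p' \<in> c. (vartheta (aca_rej A) p' q' m, Suc j) \<in> S"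
    unfolding force_def game_opts_def by auto
  then show "\<forall>c \<in> aca_trans A p (u j). \<exists>c' \<in> aca_trans A q (v j). \<forall>q' \<in> c'. \<exists>p' \<in> c.
        (vartheta (aca_rej A) p' q' m, Suc j) \<in> X"
    by (meson subsetD)
qed (auto simp: force_def game_opts_def)

definition top_pos :: "(('q \<times> 'q \<times> bool) \<times> nat) set" where
  "top_pos = {((p, q, m), j). m}"

lemma top_pos_iff [simp]: "((p, q, m), j) \<in> top_pos \<longleftrightarrow> m"
  unfolding top_pos_def by simp

text \<open>From \<open>late M w R k\<close> one can avoid rejecting states after the absolute time \<open>k\<close> until \<open>R\<close> is
  entered. Unlike the approximants of \<^const>\<open>cobuchi\<close>, the stages of \<open>timed\<close> are closed under
  \<^const>\<open>force\<close>, so the opponent can stay outside a stage even when a rejecting state is visited.\<close>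
definition late :: "('q, 'v) aca \<Rightarrow> 'v word \<Rightarrow> ('q \<times> nat) set \<Rightarrow> nat \<Rightarrow> ('q \<times> nat) set" where
  "late M w R k = gfp (\<lambda>Y. R \<union> ({(q, j). j \<le> k \<or> q \<notin> aca_rej M} \<inter> force (aca_opts M w) Y))"

definition timed :: "('q, 'v) aca \<Rightarrow> 'v word \<Rightarrow> ('q \<times> nat) set \<Rightarrow> ('q \<times> nat) set" where
  "timed M w R = (\<Union>k. late M w R k)"

section \<open>Closure of the rank stages under forcing\<close>

lemma mono_late_inner:
  "mono (\<lambda>Y. R \<union> ({(q, j). j \<le> k \<or> q \<notin> aca_rej M} \<inter> force (aca_opts M w) Y))"
  by (rule monoI) (use force_mono in blast)

lemma late_iff:
  "(q, j) \<in> late M w R k \<longleftrightarrow> (q, j) \<in> R \<or>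
     (j \<le> k \<or> q \<notin> aca_rej M) \<and> (q, j) \<in> force (aca_opts M w) (late M w R k)"
proof -
  have "late M w R k = R \<union> ({(q, j). j \<le> k \<or> q \<notin> aca_rej M} \<inter> force (aca_opts M w) (late M w R k))"
    unfolding late_def by (rule gfp_unfold[OF mono_late_inner])
  from arg_cong[OF this, of "\<lambda>S. (q, j) \<in> S"] show ?thesis by simp
qed

lemma late_coinduct:
  assumes "\<And>q j. (q, j) \<in> S \<Longrightarrow> (q, j) \<in> R \<or>
     (j \<le> k \<or> q \<notin> aca_rej M) \<and> (q, j) \<in> force (aca_opts M w) (S \<union> late M w R k)"
  shows "S \<subseteq> late M w R k"
  unfolding late_def
proof (rule coinduct[OF mono_late_inner], fold late_def, rule subrelI)
  fix q j assume "(q, j) \<in> S"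
  from assms[OF this] show "(q, j) \<in> R \<union> ({(q, j). j \<le> k \<or> q \<notin> aca_rej M} \<inter>
      force (aca_opts M w) (S \<union> late M w R k))"
    by auto
qed

lemma late_mono:
  assumes "R \<subseteq> R'" "k \<le> k'"
  shows "late M w R k \<subseteq> late M w R' k'"
proof (rule late_coinduct)
  fix q j assume "(q, j) \<in> late M w R k"
  then show "(q, j) \<in> R' \<or> (j \<le> k' \<or> q \<notin> aca_rej M) \<and>
      (q, j) \<in> force (aca_opts M w) (late M w R k \<union> late M w R' k')"
    using assms force_mono[of "late M w R k" "late M w R k \<union> late M w R' k'" "aca_opts M w"]
    unfolding late_iff[of q j M w R k] by auto
qed

lemma mono_timed: "mono (timed M w)"
proof (rule monoI)
  fix X Y :: "('a \<times> nat) set" assume "X \<subseteq> Y"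
  then show "timed M w X \<subseteq> timed M w Y"
    unfolding timed_def by (intro UN_mono late_mono) auto
qed

text \<open>The bounds of the finitely many successors have a maximum. Inserting \<open>j\<close>
  into it permits \<open>q\<close> itself to be rejecting at time \<open>j\<close>.\<close>

lemma force_timed:
  assumes fb: "finitely_branching M w" and q: "q \<in> aca_states M"
    and f: "(q, j) \<in> force (aca_opts M w) (timed M w R)"
  shows "(q, j) \<in> timed M w R"
proof -
  obtain c where c: "c \<in> aca_trans M q (w j)" "\<forall>q' \<in> c. \<exists>k. (q', Suc j) \<in> late M w R k"
    using f unfolding force_aca timed_def by auto
  then obtain k where k: "\<And>q'. q' \<in> c \<Longrightarrow> (q', Suc j) \<in> late M w R (k q')" by metis
  have fin: "finite c" using fb q c(1) unfolding finitely_branching_def by blast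
  let ?k = "Max (insert j (k ` c))"
  have "k q' \<le> ?k" if "q' \<in> c" for q' using that fin by simp
  then have "(q', Suc j) \<in> late M w R ?k" if "q' \<in> c" for q'
    using k[OF that] that late_mono[of R R "k q'" ?k M w] by blast
  moreover have "j \<le> ?k" using fin by simp
  ultimately have "(q, j) \<in> late M w R ?k" unfolding late_iff[of q] force_aca using c(1) by blast
  then show ?thesis unfolding timed_def by blast
qed

text \<open>At a union, the finitely many successors already lie in one member because the stages
  form a chain. Contrapositively, from a position outside a stage the opponent can remain outside
  it.\<close>

lemma force_stage:
  assumes fb: "finitely_branching M w" and R: "R \<in> stages (timed M w)"
    and q: "q \<in> aca_states M" and f: "(q, j) \<in> force (aca_opts M w) R"
  shows "(q, j) \<in> R"
  using R f
proof induction
  case (step R)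
  then show ?case using force_timed[OF fb q] by blast
next
  case (Union M')
  obtain c where c: "c \<in> aca_trans M q (w j)" "\<And>q'. q' \<in> c \<Longrightarrow> (q', Suc j) \<in> \<Union>M'"
    using Union.prems unfolding force_aca by auto
  have fin: "finite c" "c \<noteq> {}" using fb q c(1) unfolding finitely_branching_def by blast+
  have "subset.chain UNIV M'"
    unfolding subset_chain_def
    using stages_dichotomy[OF mono_timed] stages_increasing[OF mono_timed] Union.hyps
    by (metis order_trans subset_UNIV)
  moreover have "M' \<noteq> {}" using c(2) fin(2) by blast
  moreover have "(\<lambda>q'. (q', Suc j)) ` c \<subseteq> \<Union>M'" using c(2) by blast
  ultimately obtain R where R: "R \<in> M'" "(\<lambda>q'. (q', Suc j)) ` c \<subseteq> R"
    using finite_subset_Union_chain[of "(\<lambda>q'. (q', Suc j)) ` c" M' UNIV] fin(1) by blast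
  then have "(q, j) \<in> force (aca_opts M w) R" unfolding force_aca using c(1) by blast
  then show ?case using Union.IH R(1) by blast
qed

text \<open>Since \<open>?R\<close> is closed under forcing, the exit moves of
  \<open>cobuchi_step\<close> start inside \<open>?R\<close> already, so the bound \<open>0\<close>
  suffices in \<open>late\<close>.\<close>

lemma aca_win_timed:
  assumes fb: "finitely_branching M w" and win: "(q, j) \<in> aca_win M w" and q: "q \<in> aca_states M"
  shows "(q, j) \<in> lfp (timed M w)"
proof -
  let ?R = "lfp (timed M w)" and ?Q = "{(q, j :: nat). q \<in> aca_states M}"
  let ?F = "aca_rej M \<times> (UNIV :: nat set)"
  \<comment> \<open>\<open>- ?Q\<close> is added because \<open>force_stage\<close> speaks about
    states of the automaton; \<open>restrict\<close> keeps all moves inside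
    \<open>?Q\<close>.\<close>
  let ?G = "cobuchi_step (aca_opts M w) ?F (?R \<union> - ?Q)"
  have R: "?R \<in> stages (timed M w)" by (rule lfp_in_stages[OF mono_timed])
  have restrict: "(q, j) \<in> force (aca_opts M w) (X \<inter> ?Q)"
    if f: "(q, j) \<in> force (aca_opts M w) X" and q: "q \<in> aca_states M" for q j X
  proof -
    obtain c where c: "c \<in> aca_trans M q (w j)" "\<And>q'. q' \<in> c \<Longrightarrow> (q', Suc j) \<in> X"
      using f unfolding force_aca by blast
    then have "c \<subseteq> aca_states M" using fb q unfolding finitely_branching_def by simp
    then show ?thesis unfolding force_aca using c by (intro bexI[of _ c]) auto
  qed
  have "?G \<inter> ?Q \<subseteq> late M w ?R 0"
  proof (rule late_coinduct)
    fix q j assume "(q, j) \<in> ?G \<inter> ?Q"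
    then have G: "(q, j) \<in> ?G" and q: "q \<in> aca_states M" by auto
    from cobuchi_stepD[OF G]
    consider "(q, j) \<in> force (aca_opts M w) ?G" "q \<notin> aca_rej M"
      | "(q, j) \<in> force (aca_opts M w) (?R \<union> - ?Q)" by auto
    then show "(q, j) \<in> ?R \<or> (j \<le> 0 \<or> q \<notin> aca_rej M) \<and>
        (q, j) \<in> force (aca_opts M w) (?G \<inter> ?Q \<union> late M w ?R 0)"
    proof cases
      case 1
      then show ?thesis
        using restrict[OF 1(1) q] force_mono[of "?G \<inter> ?Q" "?G \<inter> ?Q \<union> late M w ?R 0" "aca_opts M w"] 1(2)
        by (metis (no_types, lifting) Un_upper1 subsetD)
    next
      case 2
      have "(q, j) \<in> force (aca_opts M w) ?R"
        by (rule subsetD[OF force_mono restrict[OF 2 q]]) blast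
      then show ?thesis using force_stage[OF fb R q] by blast
    qed
  qed
  also have "\<dots> \<subseteq> timed M w ?R" unfolding timed_def by blast
  also have "\<dots> = ?R" by (rule lfp_unfold[OF mono_timed, symmetric])
  finally have "?G \<subseteq> ?R \<union> - ?Q" by blast
  then have "aca_win M w \<subseteq> ?R \<union> - ?Q" unfolding aca_win_def cobuchi_def by (rule lfp_lowerbound)
  then show ?thesis using win q by blast
qed

section \<open>Duplicator against an actual and an imaginary alternative\<close>

locale dominance_game =
  fixes A :: "('q, 'v) aca" and u v :: "'v word"
  assumes fb_u: "finitely_branching A u" and fb_v: "finitely_branching A v"
begin

abbreviation F where "F \<equiv> aca_rej A"
abbreviation opts where "opts \<equiv> game_opts A u v"
text \<open>\<open>D\<close> is Duplicator's region in the delay-dominance game; \<open>K\<close> is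
  what the constructed automaton demands when it does not escape.\<close>

abbreviation D where "D \<equiv> buchi opts top_pos"
abbreviation K where "K \<equiv> cobuchi opts (- top_pos)"

text \<open>One round against the actual alternative \<open>p\<close> and the imaginary alternative \<open>r\<close> at once.\<close>
lemma force_compose:
  assumes r: "(r, j) \<in> force (aca_opts A u) Xr" and q: "((r, q, n), j) \<in> force opts Z"
    and p: "(p, j) \<notin> force (aca_opts A u) Xp" "p \<in> aca_states A"
    and X: "\<And>p' r' q'. \<lbrakk>(r', Suc j) \<in> Xr; (p', Suc j) \<notin> Xp; p' \<in> aca_states A;
        (vartheta F r' q' n, Suc j) \<in> Z\<rbrakk> \<Longrightarrow> (vartheta F p' q' m, Suc j) \<in> X"
  shows "((p, q, m), j) \<in> force opts X"
  unfolding force_game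
proof
  fix c assume c: "c \<in> aca_trans A p (u j)"
  have "c \<subseteq> aca_states A" using fb_u p(2) c unfolding finitely_branching_def by simp
  moreover obtain p' where "p' \<in> c" "(p', Suc j) \<notin> Xp"
    using p(1) c unfolding force_aca by blast
  ultimately have p': "p' \<in> c" "(p', Suc j) \<notin> Xp" "p' \<in> aca_states A" by auto
  \<comment> \<open>Duplicator answers the actual disjunct \<open>c\<close> with the reply
    \<open>c'\<close> intended for the imaginary disjunct \<open>cr\<close>. The actual
    \<open>p'\<close> is fixed beforehand and does not depend on \<open>q'\<close>.\<close>
  obtain cr where cr: "cr \<in> aca_trans A r (u j)" "\<And>r'. r' \<in> cr \<Longrightarrow> (r', Suc j) \<in> Xr"
    using r unfolding force_aca by blast
  then obtain c' where c': "c' \<in> aca_trans A q (v j)"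
      "\<And>q'. q' \<in> c' \<Longrightarrow> \<exists>r' \<in> cr. (vartheta F r' q' n, Suc j) \<in> Z"
    using q unfolding force_game by meson
  have "(vartheta F p' q' m, Suc j) \<in> X" if "q' \<in> c'" for q'
    using c'(2)[OF that] X[OF cr(2) p'(2,3)] by blast
  then show "\<exists>c' \<in> aca_trans A q (v j). \<forall>q' \<in> c'. \<exists>p' \<in> c. (vartheta F p' q' m, Suc j) \<in> X"
    using c'(1) p'(1) by blast
qed

text \<open>If the imaginary alternative \<open>r\<close> has already dropped into the stage \<open>R\<close> and the actual
  alternative \<open>p\<close> has not, Duplicator keeps the flag at bottom only finitely often, whatever it is now.\<close>
definition settled :: "('q \<times> nat) set \<Rightarrow> bool" where
  "settled R \<longleftrightarrow> (\<forall>p r q n m j. (r, j) \<in> R \<longrightarrow> (p, j) \<notin> R \<longrightarrow> p \<in> aca_states A \<longrightarrow>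
     ((r, q, n), j) \<in> D \<longrightarrow> (p \<in> F \<longrightarrow> m) \<longrightarrow> ((p, q, m), j) \<in> K)"

lemma settledD:
  "\<lbrakk>settled R; (r, j) \<in> R; (p, j) \<notin> R; p \<in> aca_states A; ((r, q, n), j) \<in> D; p \<in> F \<Longrightarrow> m\<rbrakk>
    \<Longrightarrow> ((p, q, m), j) \<in> K"
  unfolding settled_def by metis

text \<open>The pending obligation drives the imaginary \<open>r\<close> through \<open>F\<close>
  within finitely many rounds, and after time \<open>k\<close> that is possible only once
  \<open>r\<close> has entered \<open>R\<close>, where \<open>settled\<close> applies. Meanwhile
  \<open>force_stage\<close> keeps \<open>p\<close> outside \<open>R\<close>. The induction follows
  the inner least fixpoint of \<open>D\<close>.\<close>

lemma pending_in_K: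
  assumes R: "R \<in> stages (timed A u)" and settled: "settled R"
    and D: "((r, q, False), j) \<in> D" and r: "(r, j) \<in> late A u R k" and j: "k \<le> j"
    and p: "(p, j) \<notin> R" "p \<in> aca_states A" and m: "p \<in> F \<Longrightarrow> m"
  shows "((p, q, m), j) \<in> K"
proof -
  let ?g = "\<lambda>Y. (force opts D \<inter> top_pos) \<union> force opts Y"
  \<comment> \<open>Top flags satisfy \<open>?P\<close> trivially, so the induction bears on pending
    positions alone.\<close>
  let ?P = "{((r, q, n), j). n \<or> (\<forall>p m. (r, j) \<in> late A u R k \<longrightarrow> k \<le> j \<longrightarrow> (p, j) \<notin> R \<longrightarrow>
      p \<in> aca_states A \<longrightarrow> (p \<in> F \<longrightarrow> m) \<longrightarrow> ((p, q, m), j) \<in> K)}"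
  have D_lfp: "D = lfp ?g" using buchi_unfold[of opts top_pos] unfolding buchi_step_def .
  have "lfp ?g \<subseteq> ?P"
  proof (rule lfp_induct[OF mono_buchi_inner], fold D_lfp)
    show "?g (D \<inter> ?P) \<subseteq> ?P"
    proof
      fix x assume x: "x \<in> ?g (D \<inter> ?P)"
      obtain r q n j where xeq: "x = ((r, q, n), j)" by (metis prod.exhaust)
      show "x \<in> ?P"
      proof (cases n)
        case True
        then show ?thesis using xeq by simp
      next
        case False
        then have f: "((r, q, False), j) \<in> force opts (D \<inter> ?P)" using x xeq by auto
        have "((p, q, m), j) \<in> K"
          if r: "(r, j) \<in> late A u R k" and j: "k \<le> j" and p: "(p, j) \<notin> R" "p \<in> aca_states A"
            and m: "p \<in> F \<longrightarrow> m" for p m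
        proof (cases "(r, j) \<in> R")
          case True
          have "((r, q, n), j) \<in> D"
            using f False force_mono[of "D \<inter> ?P" D opts] force_buchi[of opts top_pos] by auto
          then show ?thesis using settledD[OF settled True p] m by blast
        next
          case False
          then have r': "(r, j) \<in> force (aca_opts A u) (late A u R k)" using r late_iff by metis
          have p': "(p, j) \<notin> force (aca_opts A u) R" using force_stage[OF fb_u R p(2)] p(1) by blast
          have "((p, q, m), j) \<in> force opts K"
          proof (rule force_compose[OF r' f p' p(2)])
            fix p' r' q'
            assume r': "(r', Suc j) \<in> late A u R k" and p': "(p', Suc j) \<notin> R" "p' \<in> aca_states A"
              and "(vartheta F r' q' False, Suc j) \<in> D \<inter> ?P"
            then have D': "((r', q', r' \<in> F), Suc j) \<in> D" and P': "((r', q', r' \<in> F), Suc j) \<in> ?P"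
              by (auto simp: vartheta_eq)
            show "(vartheta F p' q' m, Suc j) \<in> K"
            proof (cases "r' \<in> F")
              case True
              then have "(r', Suc j) \<in> R" using r' j unfolding late_iff[of r'] by auto
              then show ?thesis using settledD[OF settled _ p' D'] by (simp add: vartheta_eq)
            next
              case False
              then show ?thesis using P' r' j p' by (simp add: vartheta_eq)
            qed
          qed
          then show ?thesis using force_cobuchi[of opts "- top_pos"] by blast
        qed
        then show ?thesis using xeq by simp
      qed
    qed
  qed
  then have "((r, q, False), j) \<in> ?P" using D D_lfp by blast
  then show ?thesis using r j p m by simp
qed

text \<open>Coinduction: before entering \<open>R\<close>, \<open>r\<close> avoids \<open>F\<close>
  after time \<open>k\<close>, so both flags stay top as long as \<open>q\<close> avoids
  \<open>F\<close>. The first visit of \<open>q\<close> turns the imaginary flag to bottom and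
  \<open>pending_in_K\<close> takes over; if \<open>r\<close> drops into \<open>R\<close>,
  \<open>settled\<close> does.\<close>

lemma calm_in_K:
  assumes R: "R \<in> stages (timed A u)" and settled: "settled R"
    and D: "((r, q, True), j) \<in> D" and r: "(r, j) \<in> late A u R k" and j: "k \<le> j"
    and p: "(p, j) \<notin> R" "p \<in> aca_states A"
  shows "((p, q, True), j) \<in> K"
proof -
  let ?S = "{((p, q, m), j). m \<and> k \<le> j \<and> (p, j) \<notin> R \<and> p \<in> aca_states A \<and>
      (\<exists>r. (r, j) \<in> late A u R k \<and> ((r, q, True), j) \<in> D)}"
  have "?S \<subseteq> cobuchi_step opts (- top_pos) K"
  proof (rule cobuchi_step_coinduct, unfold cobuchi_unfold[symmetric], rule subsetI)
    fix x assume "x \<in> ?S"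
    then obtain p q r j where xeq: "x = ((p, q, True), j)" and j: "k \<le> j"
      and p: "(p, j) \<notin> R" "p \<in> aca_states A"
      and r: "(r, j) \<in> late A u R k" and D: "((r, q, True), j) \<in> D" by auto
    have "((p, q, True), j) \<in> force opts (?S \<union> K)"
    proof (cases "(r, j) \<in> R")
      case True
      then have "((p, q, True), j) \<in> K" using settledD[OF settled True p D] by blast
      then show ?thesis using cobuchi_force[of opts "- top_pos"] force_mono[of K "?S \<union> K" opts] by blast
    next
      case False
      then have r': "(r, j) \<in> force (aca_opts A u) (late A u R k)" using r late_iff by metis
      have p': "(p, j) \<notin> force (aca_opts A u) R" using force_stage[OF fb_u R p(2)] p(1) by blast
      have D': "((r, q, True), j) \<in> force opts D" using D buchi_force[of opts top_pos] by blast
      show ?thesis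
      proof (rule force_compose[OF r' D' p' p(2)])
        fix p' r' q'
        assume r': "(r', Suc j) \<in> late A u R k" and p': "(p', Suc j) \<notin> R" "p' \<in> aca_states A"
          and "(vartheta F r' q' True, Suc j) \<in> D"
        then have D': "((r', q', r' \<in> F \<or> q' \<notin> F), Suc j) \<in> D" by (simp add: vartheta_eq)
        show "(vartheta F p' q' True, Suc j) \<in> ?S \<union> K"
        proof (cases "r' \<in> F")
          case True
          then have "(r', Suc j) \<in> R" using r' j unfolding late_iff[of r'] by auto
          then have "((p', q', p' \<in> F \<or> q' \<notin> F), Suc j) \<in> K"
            using settledD[OF settled _ p' D'] by simp
          then show ?thesis by (simp add: vartheta_eq)
        next
          case notF: False
          show ?thesis
          proof (cases "q' \<in> F")
            case True
            then have "((r', q', False), Suc j) \<in> D" using D' notF by simp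
            then have "((p', q', p' \<in> F \<or> q' \<notin> F), Suc j) \<in> K"
              using pending_in_K[OF R settled _ r' _ p'] j by simp
            then show ?thesis by (simp add: vartheta_eq)
          next
            case False
            then show ?thesis using D' j p' r' by (auto simp: vartheta_eq)
          qed
        qed
      qed
    qed
    then show "x \<in> (force opts (?S \<union> K) - - top_pos) \<union> force opts K" using xeq by simp
  qed
  then show ?thesis using D r j p unfolding cobuchi_unfold[symmetric] by blast
qed

text \<open>Here \<open>p\<close> can still be driven through a rejecting state after time \<open>k\<close>; from then on
  \<open>calm_in_K\<close> and \<open>pending_in_K\<close> apply.\<close>
lemma delayed_in_K:
  assumes R: "R \<in> stages (timed A u)" and settled: "settled R"
    and D: "((r, q, n), j) \<in> D" and r: "(r, j) \<in> late A u R (Suc k)"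
    and p: "(p, j) \<notin> late A u R k" "p \<in> aca_states A" and m: "p \<in> F \<Longrightarrow> m"
  shows "((p, q, m), j) \<in> K"
proof (rule ccontr)
  assume notK: "((p, q, m), j) \<notin> K"
  \<comment> \<open>The alternatives for which the claim fails. Coinduction places them in
    \<open>late A u R k\<close>, contradicting the choice of \<open>p\<close>.\<close>
  let ?S = "{(p, j). p \<in> aca_states A \<and> (\<exists>r q n m. (r, j) \<in> late A u R (Suc k) \<and>
      ((r, q, n), j) \<in> D \<and> (p \<in> F \<longrightarrow> m) \<and> ((p, q, m), j) \<notin> K)}"
  have "?S \<subseteq> late A u R k"
  proof (rule late_coinduct)
    fix p j assume "(p, j) \<in> ?S"
    then obtain r q n m where p: "p \<in> aca_states A" and r: "(r, j) \<in> late A u R (Suc k)"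
      and D: "((r, q, n), j) \<in> D" and m: "p \<in> F \<Longrightarrow> m" and notK: "((p, q, m), j) \<notin> K" by blast
    show "(p, j) \<in> R \<or> (j \<le> k \<or> p \<notin> F) \<and> (p, j) \<in> force (aca_opts A u) (?S \<union> late A u R k)"
    proof (cases "(p, j) \<in> R")
      case True
      then show ?thesis ..
    next
      case pR: False
      have "(r, j) \<notin> R" using settledD[OF settled _ pR p D] m notK by blast
      then have r': "(r, j) \<in> force (aca_opts A u) (late A u R (Suc k))" using r late_iff by metis
      have D': "((r, q, n), j) \<in> force opts D" using D buchi_force[of opts top_pos] by blast
      \<comment> \<open>A rejecting \<open>p\<close> beyond time \<open>k\<close> has its flag at
        top, and there the two preceding lemmas with bound \<open>Suc k\<close> already give
        \<open>K\<close>.\<close>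
      have "j \<le> k \<or> p \<notin> F"
      proof (rule ccontr)
        assume "\<not> (j \<le> k \<or> p \<notin> F)"
        then have "Suc k \<le> j" "m" using m by auto
        then show False
          using calm_in_K[OF R settled _ r _ pR p] pending_in_K[OF R settled _ r _ pR p] D notK
          by (cases n) auto
      qed
      \<comment> \<open>Otherwise Duplicator could steer the actual alternative out of this set, and
        \<open>force_compose\<close> would yield \<open>K\<close>.\<close>
      moreover have "(p, j) \<in> force (aca_opts A u) (?S \<union> late A u R k)"
      proof (rule ccontr)
        assume p': "(p, j) \<notin> force (aca_opts A u) (?S \<union> late A u R k)"
        have "((p, q, m), j) \<in> force opts K"
        proof (rule force_compose[OF r' D' p' p])
          fix p' r' q'
          assume "(r', Suc j) \<in> late A u R (Suc k)" "(p', Suc j) \<notin> ?S \<union> late A u R k"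
            "p' \<in> aca_states A" "(vartheta F r' q' n, Suc j) \<in> D"
          then show "(vartheta F p' q' m, Suc j) \<in> K" unfolding vartheta_eq by blast
        qed
        then show False using notK force_cobuchi[of opts "- top_pos"] by blast
      qed
      ultimately show ?thesis by simp
    qed
  qed
  moreover have "(p, j) \<in> ?S" using D r p(2) m notK by blast
  ultimately show False using p(1) by blast
qed

text \<open>At a successor, \<open>r\<close> has some bound \<open>k\<close>, raised to
  \<open>Suc k\<close> by monotonicity, whereas \<open>p\<close> has none, so
  \<open>delayed_in_K\<close> applies. At a union, a member containing \<open>r\<close> omits
  \<open>p\<close>.\<close>

lemma stages_settled:
  assumes "R \<in> stages (timed A u)"
  shows "settled R"
  using assms
proof induction
  case (step R)
  show ?case unfolding settled_def
  proof (intro allI impI)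
    fix p r q n m j
    assume r: "(r, j) \<in> timed A u R" and p: "(p, j) \<notin> timed A u R" "p \<in> aca_states A"
      and D: "((r, q, n), j) \<in> D" and m: "p \<in> F \<longrightarrow> m"
    obtain k where k: "(r, j) \<in> late A u R k" using r unfolding timed_def by blast
    then have "(r, j) \<in> late A u R (Suc k)" using late_mono[of R R k "Suc k" A u] by auto
    moreover have "(p, j) \<notin> late A u R k" using p unfolding timed_def by blast
    ultimately show "((p, q, m), j) \<in> K" using delayed_in_K[OF step.hyps step.IH D] p(2) m by blast
  qed
next
  case (Union M)
  then show ?case unfolding settled_def by blast
qed

text \<open>Both alternatives start in \<open>q0\<close>, so \<open>k\<close> is chosen least:
  membership at \<open>Suc k'\<close> and failure at \<open>k'\<close> is exactly the situation of
  \<open>delayed_in_K\<close>, with the same state in both roles. For \<open>k = 0\<close> the play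
  is calm from the start.\<close>

lemma duplicator_wins_cobuchi:
  assumes win: "(q0, 0) \<in> aca_win A u" and D: "((q0, q0, True), 0) \<in> D" and q0: "q0 \<in> aca_states A"
  shows "((q0, q0, True), 0) \<in> K"
proof -
  let ?R = "stage (timed A u) (q0, 0)"
  have R: "?R \<in> stages (timed A u)" by (rule stage_in_stages)
  have "(q0, 0) \<in> lfp (timed A u)" by (rule aca_win_timed[OF fb_u win q0])
  note entry = stage_entry[OF mono_timed this]
  define k where "k = (LEAST k. (q0, 0) \<in> late A u ?R k)"
  have "\<exists>k. (q0, 0) \<in> late A u ?R k" using entry(1) unfolding timed_def by blast
  then have k: "(q0, 0) \<in> late A u ?R k" unfolding k_def by (rule LeastI_ex)
  show ?thesis
  proof (cases k)
    case 0
    show ?thesis using calm_in_K[OF R stages_settled[OF R] D k _ entry(2) q0] 0 by simp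
  next
    case (Suc k')
    then have "(q0, 0) \<notin> late A u ?R k'" using not_less_Least[of k' "\<lambda>k. (q0, 0) \<in> late A u ?R k"] unfolding k_def by simp
    then show ?thesis using delayed_in_K[OF R stages_settled[OF R] D _ _ q0] k Suc by blast
  qed
qed

end

section \<open>The delay-dominance game as a Buechi game\<close>

text \<open>The flag changes only when a new round begins. Reading the initial position leaves it
  top, since both states agree there.\<close>

fun memory_upd :: "'q set \<Rightarrow> bool \<Rightarrow> 'q gpos \<Rightarrow> bool" where
  "memory_upd F m (GP p q j) = (p \<in> F \<or> m \<and> q \<notin> F)"
| "memory_upd F m _ = m"

definition memory :: "'q set \<Rightarrow> 'q gpos list \<Rightarrow> bool" where
  "memory F h = foldl (memory_upd F) True h"

lemma memory_snoc: "memory F (h @ [y]) = memory_upd F (memory F h) y"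
  unfolding memory_def by simp

lemma memory_append: "memory F (h @ ys) = foldl (memory_upd F) (memory F h) ys"
  unfolding memory_def by simp

text \<open>The initial top flag is sound because \<open>p 0 = q 0\<close>: a demand raised at time
  \<open>0\<close> is answered at time \<open>0\<close>.\<close>

lemma top_infinitely_often_iff:
  assumes m0: "m 0" and m: "\<And>i. m (Suc i) \<longleftrightarrow> p (Suc i) \<in> F \<or> m i \<and> q (Suc i) \<notin> F"
    and start: "p 0 = q 0"
  shows "(\<forall>n. \<exists>i\<ge>n. m i) \<longleftrightarrow> (\<forall>i. q i \<in> F \<longrightarrow> (\<exists>i'\<ge>i. p i' \<in> F))"
proof (intro iffI allI impI)
  fix i assume inf: "\<forall>n. \<exists>i\<ge>n. m i" and q: "q i \<in> F"
  show "\<exists>i'\<ge>i. p i' \<in> F"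
  proof (rule ccontr)
    assume "\<not> (\<exists>i'\<ge>i. p i' \<in> F)"
    then have p: "p i' \<notin> F" if "i \<le> i'" for i' using that by simp
    have "\<not> m i'" if "i \<le> i'" for i'
      using that
    proof (induction rule: dec_induct)
      case base
      show ?case using q p[of i] m start by (cases i) auto
    next
      case (step i')
      then show ?case using m[of i'] p[of "Suc i'"] by simp
    qed
    then show False using inf by blast
  qed
next
  fix n assume resp: "\<forall>i. q i \<in> F \<longrightarrow> (\<exists>i'\<ge>i. p i' \<in> F)"
  show "\<exists>i\<ge>n. m i"
  proof (rule ccontr)
    assume "\<not> (\<exists>i\<ge>n. m i)"
    then have n: "\<forall>i\<ge>n. \<not> m i" by simp
    \<comment> \<open>The first time from which the flag stays bottom. It falls at \<open>N\<close>,
      so \<open>q N\<close> is in \<open>F\<close>, and the visit of \<open>p\<close> that answers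
      this would raise it again.\<close>
    define N where "N = (LEAST N. \<forall>i\<ge>N. \<not> m i)"
    have N: "\<forall>i\<ge>N. \<not> m i" unfolding N_def using n by (rule LeastI)
    then have "N \<noteq> 0" using m0 by auto
    then obtain N' where N': "N = Suc N'" using not0_implies_Suc by blast
    have "\<not> (\<forall>i\<ge>N'. \<not> m i)" using not_less_Least[of N' "\<lambda>N. \<forall>i\<ge>N. \<not> m i"] N' unfolding N_def by simp
    then obtain i where i: "i \<ge> N'" "m i" by blast
    then have "i = N'" using N N' not_less_eq_eq[of i N'] by fastforce
    then have "m N'" using i(2) by simp
    moreover have "\<not> m (Suc N')" using N N' by simp
    ultimately have "q N \<in> F" using m[of N'] N' by simp
    then obtain i' where i': "i' \<ge> N" "p i' \<in> F" using resp by blast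
    then obtain i'' where "i' = Suc i''" using N' by (cases i') auto
    then have "m i'" using m i'(2) by simp
    then show False using N i'(1) by blast
  qed
qed

lemma dup_wins_play_iff:
  assumes "\<And>k. alt_st (\<rho> k) = p (k div 4)" and "\<And>k. dom_st (\<rho> k) = q (k div 4)"
  shows "dup_wins_play A \<rho> \<longleftrightarrow> (\<forall>i. q i \<in> aca_rej A \<longrightarrow> (\<exists>i'\<ge>i. p i' \<in> aca_rej A))"
proof
  assume win: "dup_wins_play A \<rho>"
  show "\<forall>i. q i \<in> aca_rej A \<longrightarrow> (\<exists>i'\<ge>i. p i' \<in> aca_rej A)"
  proof (intro allI impI)
    fix i assume "q i \<in> aca_rej A"
    then have "dom_st (\<rho> (4 * i)) \<in> aca_rej A" using assms by simp
    then have "\<exists>k'\<ge>4 * i. alt_st (\<rho> k') \<in> aca_rej A"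
      using win unfolding dup_wins_play_def by blast
    then obtain k' where "4 * i \<le> k'" "p (k' div 4) \<in> aca_rej A" using assms(1) by auto
    moreover from this(1) have "i \<le> k' div 4" by linarith
    ultimately show "\<exists>i'\<ge>i. p i' \<in> aca_rej A" by blast
  qed
next
  assume resp: "\<forall>i. q i \<in> aca_rej A \<longrightarrow> (\<exists>i'\<ge>i. p i' \<in> aca_rej A)"
  show "dup_wins_play A \<rho>"
    unfolding dup_wins_play_def
  proof (intro allI impI)
    fix k assume "dom_st (\<rho> k) \<in> aca_rej A"
    then obtain i' where i': "k div 4 \<le> i'" "p i' \<in> aca_rej A" using resp assms by auto
    \<comment> \<open>The last position of round \<open>i'\<close> still carries
      \<open>p i'\<close>, so it is not before \<open>k\<close> even if \<open>k\<close> lies inside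
      that round.\<close>
    then have "k \<le> 4 * i' + 3" by linarith
    moreover have "alt_st (\<rho> (4 * i' + 3)) \<in> aca_rej A" using i'(2) assms by simp
    ultimately show "\<exists>k'\<ge>k. alt_st (\<rho> k') \<in> aca_rej A" by blast
  qed
qed

lemma nat_4_cases:
  fixes k :: nat
  obtains i where "k = 4 * i" | i where "k = 4 * i + 1" | i where "k = 4 * i + 2" | i where "k = 4 * i + 3"
proof -
  have "k = 4 * (k div 4) + k mod 4" "k mod 4 < 4" by simp_all
  then consider "k = 4 * (k div 4)" | "k = 4 * (k div 4) + 1" | "k = 4 * (k div 4) + 2"
    | "k = 4 * (k div 4) + 3"
    by linarith
  then show thesis using that by cases blast+
qed

lemma game_play_rounds:
  assumes play: "game_play A u v \<rho>"
  obtains p q c c' where "p 0 = aca_init A" "q 0 = aca_init A"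
    and "\<And>i. \<rho> (4 * i) = GP (p i) (q i) i"
    and "\<And>i. \<rho> (4 * i + 1) = GPC (p i) (q i) (c i) i"
    and "\<And>i. \<rho> (4 * i + 2) = GPCC (p i) (q i) (c i) (c' i) i"
    and "\<And>i. \<rho> (4 * i + 3) = GPCQ (p i) (q i) (c i) (q (Suc i)) i"
    and "\<And>i. c i \<in> aca_trans A (p i) (u i)"
    and "\<And>i. c' i \<in> aca_trans A (q i) (v i)"
    and "\<And>i. q (Suc i) \<in> c' i" and "\<And>i. p (Suc i) \<in> c i"
proof -
  have moves: "gmove A u v (\<rho> k) (\<rho> (Suc k))" for k using play unfolding game_play_def by blast
  have round: "\<exists>c c' p' q'. \<rho> (4 * i + 1) = GPC p q c i \<and> \<rho> (4 * i + 2) = GPCC p q c c' i \<and>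
      \<rho> (4 * i + 3) = GPCQ p q c q' i \<and> \<rho> (4 * Suc i) = GP p' q' (Suc i) \<and>
      c \<in> aca_trans A p (u i) \<and> c' \<in> aca_trans A q (v i) \<and> q' \<in> c' \<and> p' \<in> c"
    if r: "\<rho> (4 * i) = GP p q i" for i p q
  proof -
    obtain c where c: "c \<in> aca_trans A p (u i)" "\<rho> (4 * i + 1) = GPC p q c i"
      using moves[of "4 * i"] r by auto
    obtain c' where c': "c' \<in> aca_trans A q (v i)" "\<rho> (4 * i + 2) = GPCC p q c c' i"
      using moves[of "4 * i + 1"] c(2) by auto
    obtain q' where q': "q' \<in> c'" "\<rho> (4 * i + 3) = GPCQ p q c q' i"
      using moves[of "4 * i + 2"] c'(2) by (auto simp: eval_nat_numeral)
    obtain p' where "p' \<in> c" "\<rho> (4 * Suc i) = GP p' q' (Suc i)"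
      using moves[of "4 * i + 3"] q'(2) by (auto simp: eval_nat_numeral)
    then show ?thesis using c c' q' by blast
  qed
  define p where "p i = alt_st (\<rho> (4 * i))" for i
  define q where "q i = dom_st (\<rho> (4 * i))" for i
  have GP: "\<rho> (4 * i) = GP (p i) (q i) i" for i
  proof -
    have "\<exists>p q. \<rho> (4 * i) = GP p q i"
    proof (induction i)
      case 0
      show ?case using play unfolding game_play_def by simp
    next
      case (Suc i)
      then show ?case using round by blast
    qed
    then show ?thesis unfolding p_def q_def by auto
  qed
  have "\<exists>c c'. \<rho> (4 * i + 1) = GPC (p i) (q i) c i \<and> \<rho> (4 * i + 2) = GPCC (p i) (q i) c c' i \<and>
      \<rho> (4 * i + 3) = GPCQ (p i) (q i) c (q (Suc i)) i \<and> c \<in> aca_trans A (p i) (u i) \<and>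
      c' \<in> aca_trans A (q i) (v i) \<and> q (Suc i) \<in> c' \<and> p (Suc i) \<in> c" for i
    using round[OF GP[of i]] GP[of "Suc i"] by force
  then obtain c c' where "\<And>i. \<rho> (4 * i + 1) = GPC (p i) (q i) (c i) i \<and>
      \<rho> (4 * i + 2) = GPCC (p i) (q i) (c i) (c' i) i \<and>
      \<rho> (4 * i + 3) = GPCQ (p i) (q i) (c i) (q (Suc i)) i \<and> c i \<in> aca_trans A (p i) (u i) \<and>
      c' i \<in> aca_trans A (q i) (v i) \<and> q (Suc i) \<in> c' i \<and> p (Suc i) \<in> c i"
    by metis
  moreover have "p 0 = aca_init A" "q 0 = aca_init A"
    using play GP[of 0] unfolding game_play_def by auto
  ultimately show thesis using that[of p q c c'] GP by presburger
qed

lemma play_winner: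
  fixes A :: "('q, 'v) aca"
  assumes start: "p 0 = q 0"
    and \<rho>: "\<And>i. \<rho> (4 * i) = GP (p i) (q i) i" "\<And>i. \<rho> (4 * i + 1) = GPC (p i) (q i) (c i) i"
    "\<And>i. \<rho> (4 * i + 2) = GPCC (p i) (q i) (c i) (c' i) i"
    "\<And>i. \<rho> (4 * i + 3) = GPCQ (p i) (q i) (c i) (q (Suc i)) i"
  defines "m \<equiv> \<lambda>i. memory (aca_rej A) (map \<rho> [0..<4 * i + 1])"
  shows "m (Suc i) \<longleftrightarrow> p (Suc i) \<in> aca_rej A \<or> m i \<and> q (Suc i) \<notin> aca_rej A"
    and "dup_wins_play A \<rho> \<longleftrightarrow> (\<forall>n. \<exists>i\<ge>n. m i)"
proof -
  have m_Suc: "m (Suc i) \<longleftrightarrow> p (Suc i) \<in> aca_rej A \<or> m i \<and> q (Suc i) \<notin> aca_rej A" for i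
  proof -
    have eq: "[0..<4 * Suc i + 1] = [0..<4 * i + 1] @ [4 * i + 1] @ [4 * i + 2] @ [4 * i + 3] @ [4 * Suc i]"
      by (simp add: eval_nat_numeral)
    have "map \<rho> [0..<4 * Suc i + 1] = map \<rho> [0..<4 * i + 1] @ [GPC (p i) (q i) (c i) i,
        GPCC (p i) (q i) (c i) (c' i) i, GPCQ (p i) (q i) (c i) (q (Suc i)) i,
        GP (p (Suc i)) (q (Suc i)) (Suc i)]"
      by (simp only: eq map_append list.map \<rho> append.simps)
    then show ?thesis unfolding m_def by (simp only: memory_append foldl.simps memory_upd.simps)
  qed
  then show "m (Suc i) \<longleftrightarrow> p (Suc i) \<in> aca_rej A \<or> m i \<and> q (Suc i) \<notin> aca_rej A" .
  have m_0: "m 0" using \<rho>(1)[of 0] start unfolding m_def memory_def by simp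
  have div_4: "(4 * i) div 4 = i" "(4 * i + 1) div 4 = i" "(4 * i + 2) div 4 = i" "(4 * i + 3) div 4 = i"
    for i :: nat
    by linarith+
  have "alt_st (\<rho> k) = p (k div 4)" "dom_st (\<rho> k) = q (k div 4)" for k
    by (cases k rule: nat_4_cases; simp only: \<rho> div_4; simp)+
  then show "dup_wins_play A \<rho> \<longleftrightarrow> (\<forall>n. \<exists>i\<ge>n. m i)"
    using dup_wins_play_iff[of \<rho> p q A] top_infinitely_often_iff[of m p "aca_rej A" q, OF m_0 m_Suc start]
    by blast
qed

text \<open>A positional strategy on rounds becomes a strategy on histories once
  \<open>memory\<close> recomputes the flag from the history.\<close>

lemma buchi_dup_wins_game:
  assumes D: "((aca_init A, aca_init A, True), 0) \<in> buchi (game_opts A u v) top_pos"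
  shows "dup_wins_game A u v"
proof -
  let ?opts = "game_opts A u v" and ?F = "aca_rej A"
  let ?D = "buchi ?opts top_pos"
  obtain N where N: "\<And>x. x \<in> ?D \<Longrightarrow> N x \<in> ?opts x"
    and inf: "\<And>\<rho> n. \<lbrakk>\<rho> 0 \<in> ?D; \<And>i. \<rho> (Suc i) \<in> N (\<rho> i)\<rbrakk> \<Longrightarrow> \<exists>i\<ge>n. \<rho> i \<in> top_pos"
    and ND: "\<And>x. x \<in> ?D \<Longrightarrow> N x \<subseteq> ?D"
    using buchi_strategy by metis
  have "\<exists>c'. c' \<in> aca_trans A q (v j) \<and>
      (\<forall>q' \<in> c'. \<exists>p' \<in> c. (vartheta ?F p' q' m, Suc j) \<in> N ((p, q, m), j))"
    if "((p, q, m), j) \<in> ?D" "c \<in> aca_trans A p (u j)" for p q m j c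
    using N[OF that(1)] that(2) unfolding game_opts_def by auto
  then obtain C where C: "\<And>p q m j c. \<lbrakk>((p, q, m), j) \<in> ?D; c \<in> aca_trans A p (u j)\<rbrakk> \<Longrightarrow>
      C p q m j c \<in> aca_trans A q (v j) \<and>
      (\<forall>q' \<in> C p q m j c. \<exists>p' \<in> c. (vartheta ?F p' q' m, Suc j) \<in> N ((p, q, m), j))"
    by metis
  have "\<exists>p'. p' \<in> c \<and> (vartheta ?F p' q' m, Suc j) \<in> N ((p, q, m), j)"
    if "((p, q, m), j) \<in> ?D" "c \<in> aca_trans A p (u j)" "q' \<in> C p q m j c" for p q m j c q'
    using C[OF that(1,2)] that(3) by blast
  then obtain P where P: "\<And>p q m j c q'. \<lbrakk>((p, q, m), j) \<in> ?D; c \<in> aca_trans A p (u j);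
      q' \<in> C p q m j c\<rbrakk> \<Longrightarrow>
      P p q m j c q' \<in> c \<and> (vartheta ?F (P p q m j c q') q' m, Suc j) \<in> N ((p, q, m), j)"
    by metis
  define pref where "pref h = (case last h of
      GPC p q c j \<Rightarrow> GPCC p q c (C p q (memory ?F h) j c) j
    | GPCQ p q c q' j \<Rightarrow> GP (P p q (memory ?F h) j c q') q' (Suc j))" for h
  \<comment> \<open>Legality is demanded on all histories, even unreachable ones; where
    \<open>pref\<close> is illegal, any legal move is taken.\<close>
  define str where
    "str h = (if gmove A u v (last h) (pref h) then pref h else SOME y. gmove A u v (last h) y)" for h
  have legal: "dup_strategy A u v str"
    unfolding dup_strategy_def str_def by (auto intro: someI)
  have "dup_wins_play A \<rho>" if play: "game_play A u v \<rho>" and cons: "consistent_with str \<rho>" for \<rho>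
  proof -
    obtain p q c c' where p0: "p 0 = aca_init A" and q0: "q 0 = aca_init A"
      and \<rho>: "\<And>i. \<rho> (4 * i) = GP (p i) (q i) i"
      "\<And>i. \<rho> (4 * i + 1) = GPC (p i) (q i) (c i) i"
      "\<And>i. \<rho> (4 * i + 2) = GPCC (p i) (q i) (c i) (c' i) i"
      "\<And>i. \<rho> (4 * i + 3) = GPCQ (p i) (q i) (c i) (q (Suc i)) i"
      and c: "\<And>i. c i \<in> aca_trans A (p i) (u i)" "\<And>i. c' i \<in> aca_trans A (q i) (v i)"
      "\<And>i. q (Suc i) \<in> c' i" "\<And>i. p (Suc i) \<in> c i"
      using game_play_rounds[OF play] by metis
    define m where "m i = memory ?F (map \<rho> [0..<4 * i + 1])" for i
    have p0q0: "p 0 = q 0" using p0 q0 by simp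
    note m_Suc = play_winner(1)[OF p0q0 \<rho>, of A, folded m_def]
    have str_eq: "\<rho> (Suc k) = pref (map \<rho> [0..<Suc k])"
      if "dup_pos (\<rho> k)" "gmove A u v (\<rho> k) (pref (map \<rho> [0..<Suc k]))" for k
      using cons that unfolding consistent_with_def str_def by simp
    have next_in: "((p (Suc i), q (Suc i), m (Suc i)), Suc i) \<in> N ((p i, q i, m i), i)"
      if D: "((p i, q i, m i), i) \<in> ?D" for i
    proof -
      let ?h = "map \<rho> [0..<4 * i + 1]"
      have h2: "map \<rho> [0..<Suc (4 * i + 1)] = ?h @ [\<rho> (4 * i + 1)]" by simp
      have h4: "map \<rho> [0..<Suc (4 * i + 3)] = ?h @ [\<rho> (4 * i + 1)] @ [\<rho> (4 * i + 2)] @ [\<rho> (4 * i + 3)]"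
        by (simp add: eval_nat_numeral)
      have mem2: "memory ?F (map \<rho> [0..<Suc (4 * i + 1)]) = m i"
        unfolding h2 memory_snoc \<rho> m_def by simp
      have mem4: "memory ?F (map \<rho> [0..<Suc (4 * i + 3)]) = m i"
        unfolding h4 append_assoc[symmetric] memory_snoc \<rho> m_def by simp
      have last2: "last (map \<rho> [0..<Suc (4 * i + 1)]) = GPC (p i) (q i) (c i) i"
        unfolding h2 \<rho> by simp
      have last4: "last (map \<rho> [0..<Suc (4 * i + 3)]) = GPCQ (p i) (q i) (c i) (q (Suc i)) i"
        unfolding h4 \<rho> by simp
      have pref2: "pref (map \<rho> [0..<Suc (4 * i + 1)])
          = GPCC (p i) (q i) (c i) (C (p i) (q i) (m i) i (c i)) i"
        unfolding pref_def last2 mem2 by simp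
      have pref4: "pref (map \<rho> [0..<Suc (4 * i + 3)])
          = GP (P (p i) (q i) (m i) i (c i) (q (Suc i))) (q (Suc i)) (Suc i)"
        unfolding pref_def last4 mem4 by simp
      have "\<rho> (Suc (4 * i + 1)) = GPCC (p i) (q i) (c i) (C (p i) (q i) (m i) i (c i)) i"
        using str_eq[of "4 * i + 1", unfolded pref2 \<rho>] C[OF D c(1)] by simp
      then have c': "c' i = C (p i) (q i) (m i) i (c i)" using \<rho>(3)[of i] by simp
      then have Pi: "P (p i) (q i) (m i) i (c i) (q (Suc i)) \<in> c i"
          "(vartheta ?F (P (p i) (q i) (m i) i (c i) (q (Suc i))) (q (Suc i)) (m i), Suc i)
            \<in> N ((p i, q i, m i), i)"
        using P[OF D c(1)] c(3)[of i] by auto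
      have "\<rho> (Suc (4 * i + 3)) = GP (P (p i) (q i) (m i) i (c i) (q (Suc i))) (q (Suc i)) (Suc i)"
        using str_eq[of "4 * i + 3", unfolded pref4 \<rho>] Pi(1) by simp
      moreover have "Suc (4 * i + 3) = 4 * Suc i" by simp
      ultimately have "p (Suc i) = P (p i) (q i) (m i) i (c i) (q (Suc i))"
        using \<rho>(1)[of "Suc i"] by (metis gpos.inject(1))
      then show ?thesis using Pi(2) unfolding vartheta_eq m_Suc by simp
    qed
    have m0: "m 0" using \<rho>(1)[of 0] p0q0 unfolding m_def memory_def by simp
    have x0: "((p 0, q 0, m 0), 0) \<in> ?D" using D m0 by (simp add: p0 q0)
    have inD: "((p i, q i, m i), i) \<in> ?D" for i
    proof (induction i)
      case 0
      show ?case by (fact x0)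
    next
      case (Suc i)
      then show ?case using next_in ND by blast
    qed
    have "\<exists>i\<ge>n. ((p i, q i, m i), i) \<in> top_pos" for n
      by (rule inf[of "\<lambda>i. ((p i, q i, m i), i)", OF x0 next_in[OF inD]])
    then have "\<forall>n. \<exists>i\<ge>n. m i" by simp
    then show ?thesis using play_winner(2)[OF p0q0 \<rho>, of A, folded m_def] by blast
  qed
  then show ?thesis unfolding dup_wins_game_def using legal by blast
qed

text \<open>Histories at round boundaries form the tree for \<open>buchi_tree\<close>, which removes
  the memory of \<open>str\<close>. \<open>succ\<close> lets Spoiler move freely and fixes
  Duplicator's moves, so branches are consistent plays.\<close>

lemma dup_wins_game_buchi:
  assumes win: "dup_wins_game A u v"
    and fb_u: "finitely_branching A u" and fb_v: "finitely_branching A v"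
  shows "((aca_init A, aca_init A, True), 0) \<in> buchi (game_opts A u v) top_pos"
proof -
  obtain str where legal: "dup_strategy A u v str"
    and wins: "\<And>\<rho>. \<lbrakk>game_play A u v \<rho>; consistent_with str \<rho>\<rbrakk> \<Longrightarrow> dup_wins_play A \<rho>"
    using win unfolding dup_wins_game_def by blast
  let ?F = "aca_rej A" and ?Q = "aca_states A"
  define H where "H = {h. h \<noteq> [] \<and> (\<exists>p q j. last h = GP p q j \<and> p \<in> ?Q \<and> q \<in> ?Q)}"
  define succ where "succ h = {h @ [a, b, d, e] | a b d e. gmove A u v (last h) a \<and>
      b = str (h @ [a]) \<and> gmove A u v a b \<and> gmove A u v b d \<and>
      e = str (h @ [a, b, d]) \<and> gmove A u v d e}" for h
  define lab where "lab h = (case last h of GP p q j \<Rightarrow> ((p, q, memory ?F h), j))" for h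
  let ?h0 = "[GP (aca_init A) (aca_init A) 0]"
  have trans_u: "aca_trans A q (u j) \<noteq> {}" "\<And>c. c \<in> aca_trans A q (u j) \<Longrightarrow> c \<noteq> {} \<and> c \<subseteq> ?Q"
    if "q \<in> ?Q" for q j
    using fb_u that unfolding finitely_branching_def by simp_all
  have trans_v: "aca_trans A q (v j) \<noteq> {}" "\<And>c. c \<in> aca_trans A q (v j) \<Longrightarrow> c \<noteq> {} \<and> c \<subseteq> ?Q"
    if "q \<in> ?Q" for q j
    using fb_v that unfolding finitely_branching_def by simp_all
  have legal': "gmove A u v (last h) (str h)"
    if "h \<noteq> []" "dup_pos (last h)" "gmove A u v (last h) y" for h y
    using legal that unfolding dup_strategy_def by blast
  have "lab ?h0 \<in> buchi (game_opts A u v) top_pos"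
  proof (rule buchi_tree[where lab = lab and succ = succ and H = H])
    show "?h0 \<in> H" using fb_u unfolding H_def finitely_branching_def by simp
    show "lab ` (succ h \<inter> H) \<in> game_opts A u v (lab h)" if h: "h \<in> H" for h
    proof -
      obtain p q j where last: "last h = GP p q j" and pq: "p \<in> ?Q" "q \<in> ?Q"
        using h unfolding H_def by blast
      have "\<exists>c' \<in> aca_trans A q (v j). \<forall>q' \<in> c'. \<exists>p' \<in> c.
          (vartheta ?F p' q' (memory ?F h), Suc j) \<in> lab ` (succ h \<inter> H)"
        if c: "c \<in> aca_trans A p (u j)" for c
      proof -
        let ?a = "GPC p q c j"
        obtain c0 where "c0 \<in> aca_trans A q (v j)" using trans_v(1)[OF pq(2), of j] by blast
        then have "gmove A u v ?a (str (h @ [?a]))"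
          using legal'[of "h @ [?a]" "GPCC p q c c0 j"] by simp
        then obtain c' where c': "c' \<in> aca_trans A q (v j)" and b: "str (h @ [?a]) = GPCC p q c c' j"
          by auto
        let ?b = "GPCC p q c c' j"
        have "\<exists>p' \<in> c. (vartheta ?F p' q' (memory ?F h), Suc j) \<in> lab ` (succ h \<inter> H)"
          if q': "q' \<in> c'" for q'
        proof -
          let ?d = "GPCQ p q c q' j"
          obtain p0 where "p0 \<in> c" using trans_u(2)[OF pq(1) c] by blast
          then have "gmove A u v ?d (str (h @ [?a, ?b, ?d]))"
            using legal'[of "h @ [?a, ?b, ?d]" "GP p0 q' (Suc j)"] by simp
          then obtain p' where p': "p' \<in> c" and e: "str (h @ [?a, ?b, ?d]) = GP p' q' (Suc j)"
            by auto
          let ?h = "h @ [?a, ?b, ?d, GP p' q' (Suc j)]"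
          have "?h \<in> succ h" unfolding succ_def using last c b c' q' e p' by simp
          moreover have "?h \<in> H"
            using trans_u(2)[OF pq(1) c] trans_v(2)[OF pq(2) c'] p' q' unfolding H_def by auto
          moreover have "lab ?h = (vartheta ?F p' q' (memory ?F h), Suc j)"
            unfolding lab_def memory_append by (simp add: vartheta_eq)
          ultimately show ?thesis using p' by (metis IntI image_eqI)
        qed
        then show ?thesis using c' by blast
      qed
      then show ?thesis unfolding lab_def last game_opts_def by simp
    qed
    show "\<exists>i\<ge>n. lab (\<beta> i) \<in> top_pos"
      if b0: "\<beta> 0 = ?h0" and bH: "\<And>i. \<beta> i \<in> H" and b: "\<And>i. \<beta> (Suc i) \<in> succ (\<beta> i)" for \<beta> n
    proof -
      \<comment> \<open>Each history is a prefix of the later ones and \<open>\<beta> k\<close> has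
        length \<open>4 * k + 1\<close>, so it contains position \<open>k\<close>.\<close>
      define \<rho> where "\<rho> k = \<beta> k ! k" for k
      have len: "length (\<beta> i) = 4 * i + 1" for i
      proof (induction i)
        case 0
        show ?case by (simp add: b0)
      next
        case (Suc i)
        then show ?case using b[of i] unfolding succ_def by auto
      qed
      have prefix: "\<exists>ys. \<beta> i' = \<beta> i @ ys" if "i \<le> i'" for i i'
        using that
      proof (induction rule: dec_induct)
        case (step i')
        then show ?case using b[of i'] unfolding succ_def by auto
      qed simp
      have \<rho>_nth: "\<rho> k = \<beta> i ! k" if "k < 4 * i + 1" for k i
      proof -
        have k: "k < length (\<beta> k)" "k < length (\<beta> i)" using that len by simp_all
        show ?thesis
        proof (cases "i \<le> k")
          case True
          then obtain ys where "\<beta> k = \<beta> i @ ys" using prefix by blast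
          then show ?thesis unfolding \<rho>_def using k(2) by (simp add: nth_append)
        next
          case False
          then obtain ys where "\<beta> i = \<beta> k @ ys" using prefix[of k i] by auto
          then show ?thesis unfolding \<rho>_def using k(1) by (simp add: nth_append)
        qed
      qed
      have hist: "map \<rho> [0..<4 * i + 1] = \<beta> i" for i
        using \<rho>_nth[of _ i] len[of i] by (intro nth_equalityI) (simp_all del: upt_Suc)
      have \<rho>_last: "\<rho> (4 * i) = last (\<beta> i)" for i
        using \<rho>_nth[of "4 * i" i] len[of i] by (simp add: last_conv_nth flip: length_0_conv)
      have step: "gmove A u v (\<rho> k) (\<rho> (Suc k)) \<and>
          (dup_pos (\<rho> k) \<longrightarrow> \<rho> (Suc k) = str (map \<rho> [0..<Suc k]))" for k
      proof -
        define i where "i = k div 4"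
        obtain a b' d e where bi: "\<beta> (Suc i) = \<beta> i @ [a, b', d, e]"
          and moves: "gmove A u v (last (\<beta> i)) a" "gmove A u v a b'" "gmove A u v b' d" "gmove A u v d e"
          and str: "b' = str (\<beta> i @ [a])" "e = str (\<beta> i @ [a, b', d])"
          using b[of i] unfolding succ_def by blast
        have r: "\<rho> (4 * i + 1) = a" "\<rho> (4 * i + 2) = b'" "\<rho> (4 * i + 3) = d" "\<rho> (4 * i + 4) = e"
          using \<rho>_nth[of _ "Suc i"] len[of i] bi by (simp_all add: nth_append)
        have h: "map \<rho> [0..<Suc (4 * i + 1)] = \<beta> i @ [a]"
            "map \<rho> [0..<Suc (4 * i + 3)] = \<beta> i @ [a, b', d]"
          using hist[of i] r by (simp_all add: eval_nat_numeral)
        obtain p q j where last: "last (\<beta> i) = GP p q j" using bH[of i] unfolding H_def by blast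
        consider "k = 4 * i" | "k = 4 * i + 1" | "k = 4 * i + 2" | "k = 4 * i + 3"
          unfolding i_def by linarith
        then show ?thesis
        proof cases
          case 1
          then show ?thesis using moves(1) r(1) \<rho>_last[of i] last by simp
        next
          case 2
          then have "\<rho> k = a" "\<rho> (Suc k) = b'" using r by simp_all
          then show ?thesis using moves(2) str(1) h(1) unfolding 2 by metis
        next
          case 3
          then have "\<rho> k = b'" "\<rho> (Suc k) = d" using r by (simp_all add: eval_nat_numeral)
          moreover have "\<not> dup_pos b'" using last moves(1,2) by auto
          ultimately show ?thesis using moves(3) by simp
        next
          case 4
          then have "\<rho> k = d" "\<rho> (Suc k) = e" using r by (simp_all add: eval_nat_numeral)
          then show ?thesis using moves(4) str(2) h(2) unfolding 4 by metis
        qed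
      qed
      have "\<rho> 0 = GP (aca_init A) (aca_init A) 0" using \<rho>_last[of 0] b0 by simp
      then have play: "game_play A u v \<rho>" unfolding game_play_def using step by blast
      have "consistent_with str \<rho>" unfolding consistent_with_def using step by blast
      then have wins_\<rho>: "dup_wins_play A \<rho>" using wins[OF play] by blast
      obtain p q c c' where "p 0 = aca_init A" "q 0 = aca_init A"
        and \<rho>: "\<And>i. \<rho> (4 * i) = GP (p i) (q i) i"
        "\<And>i. \<rho> (4 * i + 1) = GPC (p i) (q i) (c i) i"
        "\<And>i. \<rho> (4 * i + 2) = GPCC (p i) (q i) (c i) (c' i) i"
        "\<And>i. \<rho> (4 * i + 3) = GPCQ (p i) (q i) (c i) (q (Suc i)) i"
        using game_play_rounds[OF play] by metis
      then have "p 0 = q 0" by simp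
      then have "\<exists>i\<ge>n. memory ?F (\<beta> i)"
        using play_winner(2)[OF _ \<rho>, of A] wins_\<rho> unfolding hist by blast
      then show ?thesis using \<rho>(1) \<rho>_last unfolding lab_def by fastforce
    qed
  qed
  then show ?thesis unfolding lab_def memory_def by auto
qed

section \<open>The automaton of the construction\<close>

text \<open>Distributivity: a disjunct of the conjunction is a choice of one disjunct from each
  conjunct.\<close>

lemma dnf_conj_ex:
  "(\<exists>c \<in> dnf_conj X D. \<forall>y \<in> c. P y) \<longleftrightarrow> (\<forall>x \<in> X. \<exists>d \<in> D x. \<forall>y \<in> d. P y)"
proof
  assume "\<forall>x \<in> X. \<exists>d \<in> D x. \<forall>y \<in> d. P y"
  then obtain f where "\<forall>x \<in> X. f x \<in> D x \<and> (\<forall>y \<in> f x. P y)" by metis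
  then show "\<exists>c \<in> dnf_conj X D. \<forall>y \<in> c. P y"
    unfolding dnf_conj_def by (intro bexI[of _ "\<Union>x\<in>X. f x"]) auto
qed (auto simp: dnf_conj_def)

lemma bstep_ex:
  "(\<exists>c \<in> bstep A p q m \<iota> \<iota>'. \<forall>y \<in> c. P y) \<longleftrightarrow>
     (\<forall>c \<in> aca_trans A p \<iota>'. \<exists>c' \<in> aca_trans A q \<iota>. \<forall>q' \<in> c'. \<exists>p' \<in> c.
        P (Inl (vartheta (aca_rej A) p' q' m)))"
  unfolding bstep_def by (simp add: dnf_conj_ex bex_UN)

definition proper_dnf :: "'s set \<Rightarrow> 's set set \<Rightarrow> bool" where
  "proper_dnf S D \<longleftrightarrow> D \<noteq> {} \<and> (\<forall>d \<in> D. d \<noteq> {} \<and> finite d \<and> d \<subseteq> S)"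

lemma proper_dnf_conj:
  assumes X: "finite X" "X \<noteq> {}" and D: "\<And>x. x \<in> X \<Longrightarrow> proper_dnf S (D x)"
  shows "proper_dnf S (dnf_conj X D)"
proof -
  have "\<exists>d. d \<in> D x" if "x \<in> X" for x using D[OF that] unfolding proper_dnf_def by blast
  then obtain f where "\<forall>x \<in> X. f x \<in> D x" by metis
  then have "dnf_conj X D \<noteq> {}" unfolding dnf_conj_def by blast
  moreover have "c \<noteq> {} \<and> finite c \<and> c \<subseteq> S" if "c \<in> dnf_conj X D" for c
  proof -
    have "\<exists>f. c = (\<Union>x\<in>X. f x) \<and> (\<forall>x \<in> X. f x \<in> D x)"
      using that unfolding dnf_conj_def by simp
    then obtain f where c: "c = (\<Union>x\<in>X. f x)" and f: "\<And>x. x \<in> X \<Longrightarrow> f x \<in> D x" by blast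
    have "f x \<noteq> {} \<and> finite (f x) \<and> f x \<subseteq> S" if "x \<in> X" for x
      using D[OF that] f[OF that] unfolding proper_dnf_def by blast
    then show ?thesis unfolding c using X by auto
  qed
  ultimately show ?thesis unfolding proper_dnf_def by blast
qed

lemma proper_dnf_UN:
  assumes X: "X \<noteq> {}" and D: "\<And>x. x \<in> X \<Longrightarrow> proper_dnf S (D x)"
  shows "proper_dnf S (\<Union>x\<in>X. D x)"
proof -
  obtain x where "x \<in> X" using X by blast
  then have "D x \<noteq> {}" using D unfolding proper_dnf_def by simp
  then have "(\<Union>x\<in>X. D x) \<noteq> {}" using \<open>x \<in> X\<close> by blast
  moreover have "d \<noteq> {} \<and> finite d \<and> d \<subseteq> S" if "d \<in> (\<Union>x\<in>X. D x)" for d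
    using that D unfolding proper_dnf_def by auto
  ultimately show ?thesis unfolding proper_dnf_def by simp
qed

lemma proper_bstep:
  assumes wf: "aca_wf \<Sigma> A" and pq: "p \<in> aca_states A" "q \<in> aca_states A" and \<iota>: "\<iota> \<subseteq> \<Sigma>" "\<iota>' \<subseteq> \<Sigma>"
  shows "proper_dnf (Inl ` (aca_states A \<times> aca_states A \<times> UNIV)) (bstep A p q m \<iota> \<iota>')"
proof -
  have fin: "finite (aca_states A)" using wf unfolding aca_wf_def by simp
  have trans: "finite (aca_trans A q \<iota>)" "aca_trans A q \<iota> \<noteq> {}"
    "\<And>c. c \<in> aca_trans A q \<iota> \<Longrightarrow> finite c \<and> c \<noteq> {} \<and> c \<subseteq> aca_states A"
    if "q \<in> aca_states A" "\<iota> \<subseteq> \<Sigma>" for q \<iota>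
    using wf that finite_subset[OF _ fin] unfolding aca_wf_def by simp_all
  show ?thesis
    unfolding bstep_def
  proof (intro proper_dnf_conj proper_dnf_UN trans pq \<iota>)
    fix c c' q' p'
    assume "c \<in> aca_trans A p \<iota>'" "c' \<in> aca_trans A q \<iota>" "q' \<in> c'" "p' \<in> c"
    then have "p' \<in> aca_states A" "q' \<in> aca_states A"
      using trans(3)[OF pq(1) \<iota>(2)] trans(3)[OF pq(2) \<iota>(1)] by auto
    then show "proper_dnf (Inl ` (aca_states A \<times> aca_states A \<times> UNIV))
        {{Inl (vartheta (aca_rej A) p' q' m)}}"
      unfolding proper_dnf_def vartheta_eq by simp
  next
    show "finite c'" "c' \<noteq> {}" if "c' \<in> aca_trans A q \<iota>" for c'
      using trans(3)[OF pq(2) \<iota>(1) that] by simp_all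
    show "c \<noteq> {}" if "c \<in> aca_trans A p \<iota>'" for c
      using trans(3)[OF pq(1) \<iota>(2) that] by simp
  qed
qed

lemma letter_pr_subset: "letter_pr Ii Oo a \<subseteq> Ii \<union> Oo"
  unfolding letter_pr_def by blast

lemma letter_unpr_subset: "letter_unpr Ii Oo a \<subseteq> Ii \<union> Oo"
  unfolding letter_unpr_def by blast

text \<open>The word is arbitrary because \<open>letter_pr\<close> and \<open>letter_unpr\<close>
  cut each letter down to the alphabet of \<open>A\<close> and \<open>C\<close>.\<close>

lemma finitely_branching_constrB:
  fixes A :: "('q, 'v) aca" and C :: "('c, 'v) aca"
  assumes A: "aca_wf (Ii \<union> Oo) A" and C: "aca_wf (Ii \<union> Oo) C"
  shows "finitely_branching (constrB Ii Oo A C) w"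
proof -
  let ?B = "constrB Ii Oo A C"
  have init: "aca_init A \<in> aca_states A" "aca_init C \<in> aca_states C"
    using A C unfolding aca_wf_def by simp_all
  have C_trans: "proper_dnf (aca_states ?B) ((\<lambda>c. Inr ` c) ` aca_trans C q (letter_pr Ii Oo a))"
    if "q \<in> aca_states C" for q a
  proof -
    have fin: "finite (aca_states C)" using C unfolding aca_wf_def by simp
    have "aca_trans C q (letter_pr Ii Oo a) \<noteq> {}"
      "\<And>c. c \<in> aca_trans C q (letter_pr Ii Oo a) \<Longrightarrow> c \<noteq> {} \<and> finite c \<and> c \<subseteq> aca_states C"
      using C that letter_pr_subset[of Ii Oo a] finite_subset[OF _ fin] unfolding aca_wf_def by simp_all
    then show ?thesis unfolding proper_dnf_def constrB_def by auto
  qed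
  have A_trans: "proper_dnf (aca_states ?B) (bstep A p q m (letter_unpr Ii Oo a) (letter_pr Ii Oo a))"
    if "p \<in> aca_states A" "q \<in> aca_states A" for p q m a
    using proper_bstep[OF A that letter_unpr_subset letter_pr_subset, of m a a]
    unfolding proper_dnf_def constrB_def by auto
  have if_Un: "proper_dnf S (if b then X \<union> Y else Y)" if "proper_dnf S X" "proper_dnf S Y"
    for b S X and Y :: "('q \<times> 'q \<times> bool + 'c) set set"
    using that unfolding proper_dnf_def by auto
  have "proper_dnf (aca_states ?B) (aca_trans ?B st (w j))" if "st \<in> aca_states ?B" for st j
  proof (cases st)
    case (Inr q)
    then have "q \<in> aca_states C" using that unfolding constrB_def by auto
    then show ?thesis using C_trans Inr unfolding constrB_def by simp
  next
    case (Inl pqm)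
    obtain p q m where pqm: "pqm = (p, q, m)" by (metis prod.exhaust)
    then have pq: "p \<in> aca_states A" "q \<in> aca_states A"
      using that Inl unfolding constrB_def by auto
    have "aca_trans ?B (Inl (p, q, m)) a = (if (p, q, m) = (aca_init A, aca_init A, True)
        then (\<lambda>c. Inr ` c) ` aca_trans C (aca_init C) (letter_pr Ii Oo a)
          \<union> bstep A p q m (letter_unpr Ii Oo a) (letter_pr Ii Oo a)
        else bstep A p q m (letter_unpr Ii Oo a) (letter_pr Ii Oo a))" for a
      by (simp add: constrB_def)
    then show ?thesis
      unfolding Inl pqm using if_Un[OF C_trans[OF init(2)] A_trans[OF pq]] by (simp only:)
  qed
  moreover have "aca_init ?B \<in> aca_states ?B" using init unfolding constrB_def by simp
  ultimately show ?thesis unfolding finitely_branching_def proper_dnf_def by simp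
qed

section \<open>Winning regions of the constructed automaton\<close>

locale dominance_automaton =
  fixes Ii Oo :: "'v set" and A :: "('q, 'v) aca" and C :: "('c, 'v) aca" and w :: "('v + 'v) word"
  assumes A: "aca_wf (Ii \<union> Oo) A" and C: "aca_wf (Ii \<union> Oo) C"
    and complement: "\<And>x. word_over (Ii \<union> Oo) x \<Longrightarrow> aca_accepts C x \<longleftrightarrow> \<not> aca_accepts A x"
begin

abbreviation u where "u \<equiv> \<lambda>j. letter_pr Ii Oo (w j)"
abbreviation v where "v \<equiv> \<lambda>j. letter_unpr Ii Oo (w j)"
abbreviation B where "B \<equiv> constrB Ii Oo A C"
abbreviation gopts where "gopts \<equiv> game_opts A u v"

lemma fb: "finitely_branching A u" "finitely_branching A v" "finitely_branching C u"
  "finitely_branching B w"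
proof -
  have "word_over (Ii \<union> Oo) u" "word_over (Ii \<union> Oo) v"
    by (simp_all add: word_over_def letter_pr_subset letter_unpr_subset)
  then show "finitely_branching A u" "finitely_branching A v" "finitely_branching C u"
    using finitely_branching_wf[OF A] finitely_branching_wf[OF C] by simp_all
  show "finitely_branching B w" by (rule finitely_branching_constrB[OF A C])
qed

lemma force_B_Inr:
  "(Inr q, j) \<in> force (aca_opts B w) X \<longleftrightarrow>
    (q, j) \<in> force (aca_opts C u) ((\<lambda>(q, j). (Inr q, j)) -` X)"
  unfolding force_aca constrB_def by simp

text \<open>The escape is open whenever the initial triple is visited, at any time
  \<open>j\<close>.\<close>

lemma force_B_Inl:
  "(Inl (p, q, m), j) \<in> force (aca_opts B w) X \<longleftrightarrow>
    ((p, q, m), j) \<in> force gopts ((\<lambda>(x, j). (Inl x, j)) -` X) \<or>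
    (p, q, m) = (aca_init A, aca_init A, True) \<and>
      (aca_init C, j) \<in> force (aca_opts C u) ((\<lambda>(q, j). (Inr q, j)) -` X)"
proof -
  have "(\<exists>c \<in> aca_trans B (Inl (p, q, m)) (w j). \<forall>y \<in> c. (y, Suc j) \<in> X) \<longleftrightarrow>
      (\<exists>c \<in> bstep A p q m (v j) (u j). \<forall>y \<in> c. (y, Suc j) \<in> X) \<or>
      (p, q, m) = (aca_init A, aca_init A, True) \<and>
        (\<exists>c \<in> aca_trans C (aca_init C) (u j). \<forall>q' \<in> c. (Inr q', Suc j) \<in> X)"
    by (cases "p = aca_init A"; cases "q = aca_init A"; cases m)
      (simp_all add: constrB_def bex_Un disj_commute)
  then show ?thesis unfolding force_aca bstep_ex force_game by simp
qed

text \<open>The \<open>Inr\<close> part is a closed copy of \<open>C\<close> reading the alternative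
  word, so the two transfer lemmas identify the regions.\<close>

lemma win_Inr: "(Inr q, j) \<in> aca_win B w \<longleftrightarrow> (q, j) \<in> aca_win C u"
proof -
  let ?h = "\<lambda>(q, j). (Inr q, j)"
  have force: "?h -` force (aca_opts B w) X = force (aca_opts C u) (?h -` X)" for X
    using force_B_Inr[of _ _ X] by auto
  have rej: "?h -` (aca_rej B \<times> UNIV) = aca_rej C \<times> UNIV"
    unfolding constrB_def by auto
  have "?h -` aca_win B w \<subseteq> aca_win C u"
    unfolding aca_win_def by (rule cobuchi_vimage_subset) (simp_all only: force rej order_refl)
  moreover have "aca_win C u \<subseteq> ?h -` aca_win B w"
    unfolding aca_win_def by (rule cobuchi_subset_vimage) (simp_all only: force rej order_refl)
  ultimately show ?thesis by auto
qed

text \<open>Membership in a region at time \<open>j\<close> means acceptance of the suffix of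
  \<open>u\<close> from \<open>j\<close>, and \<open>A\<close> and \<open>C\<close> never accept the
  same suffix.\<close>

lemma init_C_win: "(aca_init C, j) \<in> force (aca_opts C u) (aca_win C u) \<Longrightarrow>
    (aca_init A, j) \<notin> aca_win A u"
proof
  assume "(aca_init C, j) \<in> force (aca_opts C u) (aca_win C u)" and A_win: "(aca_init A, j) \<in> aca_win A u"
  then have C_win: "(aca_init C, j) \<in> aca_win C u"
    using force_cobuchi[of "aca_opts C u" "aca_rej C \<times> UNIV"] unfolding aca_win_def by blast
  have "word_over (Ii \<union> Oo) (\<lambda>k. u (k + j))"
    by (simp add: word_over_def letter_pr_subset)
  then show False
    using complement aca_win_accepts[OF A_win fb(1)] aca_win_accepts[OF C_win fb(3)] by blast
qed

text \<open>If \<open>A\<close> accepts \<open>u\<close>, Duplicator's Buechi win strengthens to a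
  co-Buechi win, which embeds into \<open>B\<close> through \<open>Inl\<close>. Otherwise
  \<open>C\<close> accepts \<open>u\<close>, and \<open>B\<close> escapes in its first step.\<close>

lemma B_accepts_if:
  assumes "dup_wins_game A u v"
  shows "aca_accepts B w"
proof -
  have D: "((aca_init A, aca_init A, True), 0) \<in> buchi gopts top_pos"
    by (rule dup_wins_game_buchi[OF assms fb(1,2)])
  have init: "aca_init A \<in> aca_states A" using A unfolding aca_wf_def by simp
  have "(Inl (aca_init A, aca_init A, True), 0) \<in> aca_win B w"
  proof (cases "aca_accepts A u")
    case True
    interpret dominance_game A u v by unfold_locales (rule fb)+
    have "((aca_init A, aca_init A, True), 0) \<in> cobuchi gopts (- top_pos)"
      by (rule duplicator_wins_cobuchi[OF aca_accepts_win[OF True] D init])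
    moreover have "cobuchi gopts (- top_pos) \<subseteq> (\<lambda>(x, j). (Inl x, j)) -` aca_win B w"
      unfolding aca_win_def
    proof (rule cobuchi_subset_vimage)
      show "force gopts ((\<lambda>(x, j). (Inl x, j)) -` X) \<subseteq> (\<lambda>(x, j). (Inl x, j)) -` force (aca_opts B w) X"
        for X
        using force_B_Inl[of _ _ _ _ X] by auto
      show "(\<lambda>(x, j). (Inl x, j)) -` (aca_rej B \<times> UNIV) \<subseteq> - top_pos"
        unfolding constrB_def by auto
    qed
    ultimately show ?thesis by auto
  next
    case False
    have "word_over (Ii \<union> Oo) u" by (simp add: word_over_def letter_pr_subset)
    then have "aca_accepts C u" using complement False by blast
    then have "(aca_init C, 0) \<in> aca_win C u" by (rule aca_accepts_win)
    then have "(aca_init C, 0) \<in> force (aca_opts C u) (aca_win C u)"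
      using cobuchi_force[of "aca_opts C u" "aca_rej C \<times> UNIV"] unfolding aca_win_def by blast
    moreover have "(\<lambda>(q, j). (Inr q, j)) -` aca_win B w = aca_win C u" using win_Inr by auto
    ultimately have "(Inl (aca_init A, aca_init A, True), 0) \<in> force (aca_opts B w) (aca_win B w)"
      unfolding force_B_Inl by simp
    then show ?thesis
      using force_cobuchi[of "aca_opts B w" "aca_rej B \<times> UNIV"] unfolding aca_win_def by blast
  qed
  then have "aca_accepts B (\<lambda>k. w (k + 0))"
    by (intro aca_win_accepts fb) (simp add: constrB_def)
  then show ?thesis by simp
qed

text \<open>The union of \<open>Z1\<close>, where \<open>B\<close> wins, and \<open>Z2\<close>,
  where the alternative run can be driven through \<open>F\<close> infinitely often, is contained in
  its own Buechi step.\<close>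

lemma dup_wins_if:
  assumes "aca_accepts B w"
  shows "dup_wins_game A u v"
proof (rule buchi_dup_wins_game)
  let ?F = "aca_rej A" and ?Q = "aca_states A"
  let ?R = "buchi (dual (aca_opts A u)) (?F \<times> UNIV)"
  define Z1 where "Z1 = {((p, q, m), j). p \<in> ?Q \<and> q \<in> ?Q \<and> (Inl (p, q, m), j) \<in> aca_win B w}"
  define Z2 where "Z2 = {((p, q, m), j). p \<in> ?Q \<and> q \<in> ?Q \<and> (p, j) \<in> ?R \<and> (p \<in> ?F \<longrightarrow> m)}"
  let ?Z = "Z1 \<union> Z2"
  let ?L = "buchi_step gopts top_pos ?Z"
  have trans_u: "c \<noteq> {} \<and> c \<subseteq> ?Q" if "p \<in> ?Q" "c \<in> aca_trans A p (u j)" for p c j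
    using fb(1) that unfolding finitely_branching_def by simp
  have trans_v: "aca_trans A p (v j) \<noteq> {}" "\<And>c. c \<in> aca_trans A p (v j) \<Longrightarrow> c \<noteq> {} \<and> c \<subseteq> ?Q"
    if "p \<in> ?Q" for p j
    using fb(2) that unfolding finitely_branching_def by simp_all
  \<comment> \<open>Duplicator picks \<open>p'\<close> by the strategy refuting \<open>A\<close> on
    \<open>u\<close>; the disjunct \<open>c'\<close> for the dominant state is arbitrary.\<close>
  have refuter_round: "((p, q, m), j) \<in> force gopts X"
    if p: "p \<in> ?Q" and q: "q \<in> ?Q" and f: "(p, j) \<in> force (dual (aca_opts A u)) Y"
      and X: "\<And>p' q'. \<lbrakk>p' \<in> ?Q; q' \<in> ?Q; (p', Suc j) \<in> Y\<rbrakk> \<Longrightarrow> (vartheta ?F p' q' m, Suc j) \<in> X"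
    for p q m j X Y
    unfolding force_game
  proof
    fix c assume c: "c \<in> aca_trans A p (u j)"
    obtain p' where p': "p' \<in> c" "(p', Suc j) \<in> Y" using f c unfolding force_dual_aca by blast
    have "p' \<in> ?Q" using trans_u[OF p c] p'(1) by blast
    obtain c' where c': "c' \<in> aca_trans A q (v j)" using trans_v(1)[OF q, of j] by blast
    have "(vartheta ?F p' q' m, Suc j) \<in> X" if "q' \<in> c'" for q'
      using X[OF \<open>p' \<in> ?Q\<close> _ p'(2)] trans_v(2)[OF q c'] that by blast
    then show "\<exists>c' \<in> aca_trans A q (v j). \<forall>q' \<in> c'. \<exists>p' \<in> c. (vartheta ?F p' q' m, Suc j) \<in> X"
      using c' p'(1) by blast
  qed
  have L: "x \<in> ?L" if "x \<in> force gopts ?Z \<and> x \<in> top_pos \<or> x \<in> force gopts ?L" for x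
    using buchi_stepI[of x gopts ?Z top_pos] that by blast
  let ?P2 = "{(p, j). \<forall>q m. p \<in> ?Q \<longrightarrow> q \<in> ?Q \<longrightarrow> (p \<in> ?F \<longrightarrow> m) \<longrightarrow> ((p, q, m), j) \<in> ?L}"
  let ?g = "\<lambda>Y. (force (dual (aca_opts A u)) ?R \<inter> (?F \<times> UNIV)) \<union> force (dual (aca_opts A u)) Y"
  have R_lfp: "?R = lfp ?g"
    using buchi_unfold[of "dual (aca_opts A u)" "?F \<times> UNIV"] unfolding buchi_step_def .
  \<comment> \<open>Induction on the inner rank of the refutation: eventually \<open>p\<close> is
    rejecting, its flag is top, and the next round returns to \<open>?Z\<close>.\<close>
  have "lfp ?g \<subseteq> ?P2"
  proof (rule lfp_induct[OF mono_buchi_inner], fold R_lfp, rule subrelI)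
    fix p j assume x: "(p, j) \<in> ?g (?R \<inter> ?P2)"
    have "((p, q, m), j) \<in> ?L" if p: "p \<in> ?Q" and q: "q \<in> ?Q" and m: "p \<in> ?F \<longrightarrow> m" for q m
    proof (cases "(p, j) \<in> force (dual (aca_opts A u)) ?R \<and> p \<in> ?F")
      case True
      have "((p, q, m), j) \<in> force gopts ?Z"
        by (rule refuter_round[OF p q conjunct1[OF True]]) (simp add: Z2_def vartheta_eq)
      then show ?thesis using L True m by simp
    next
      case False
      then have f: "(p, j) \<in> force (dual (aca_opts A u)) (?R \<inter> ?P2)" using x by auto
      have "((p, q, m), j) \<in> force gopts ?L"
        by (rule refuter_round[OF p q f]) (simp add: vartheta_eq)
      then show ?thesis using L by blast
    qed
    then show "(p, j) \<in> ?P2" by blast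
  qed
  then have P2: "((p, q, m), j) \<in> ?L" if "((p, q, m), j) \<in> Z2" for p q m j
    using that R_lfp unfolding Z2_def by blast
  \<comment> \<open>Where an escape wins, \<open>init_C_win\<close> shows that \<open>A\<close>
    loses the remaining suffix, and determinacy turns this into membership in
    \<open>?R\<close>.\<close>
  have jump: "((p, q, m), j) \<in> Z2"
    if "(p, q, m) = (aca_init A, aca_init A, True)"
      and "(aca_init C, j) \<in> force (aca_opts C u) ((\<lambda>(q, j). (Inr q, j)) -` X)"
      and "X \<subseteq> aca_win B w" for p q m j X
  proof -
    have "(\<lambda>(q, j). (Inr q, j)) -` X \<subseteq> aca_win C u" using that(3) win_Inr by auto
    then have "(aca_init C, j) \<in> force (aca_opts C u) (aca_win C u)"
      using that(2) force_mono by blast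
    then have "(aca_init A, j) \<notin> aca_win A u" by (rule init_C_win)
    then have "(aca_init A, j) \<in> ?R"
      using not_cobuchi[of "aca_opts A u" "?F \<times> UNIV"] unfolding aca_win_def by blast
    moreover have "aca_init A \<in> ?Q" using A unfolding aca_wf_def by simp
    ultimately show ?thesis using that(1) unfolding Z2_def by simp
  qed
  have restrict: "((p, q, m), j) \<in> force gopts Y"
    if f: "((p, q, m), j) \<in> force gopts X" and pq: "p \<in> ?Q" "q \<in> ?Q"
      and XY: "\<And>p q m j. \<lbrakk>p \<in> ?Q; q \<in> ?Q; ((p, q, m), j) \<in> X\<rbrakk> \<Longrightarrow> ((p, q, m), j) \<in> Y"
    for p q m j X Y
    unfolding force_game
  proof
    fix c assume c: "c \<in> aca_trans A p (u j)"
    then obtain c' where c': "c' \<in> aca_trans A q (v j)"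
      "\<And>q'. q' \<in> c' \<Longrightarrow> \<exists>p' \<in> c. (vartheta ?F p' q' m, Suc j) \<in> X"
      using f unfolding force_game by meson
    have "\<exists>p' \<in> c. (vartheta ?F p' q' m, Suc j) \<in> Y" if q': "q' \<in> c'" for q'
    proof -
      obtain p' where p': "p' \<in> c" "(vartheta ?F p' q' m, Suc j) \<in> X" using c'(2)[OF q'] by blast
      have "p' \<in> ?Q" "q' \<in> ?Q" using trans_u[OF pq(1) c] trans_v(2)[OF pq(2) c'(1)] p'(1) q' by auto
      then show ?thesis using p' XY unfolding vartheta_eq by blast
    qed
    then show "\<exists>c' \<in> aca_trans A q (v j). \<forall>q' \<in> c'. \<exists>p' \<in> c. (vartheta ?F p' q' m, Suc j) \<in> Y"
      using c'(1) by blast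
  qed
  let ?G0 = "\<lambda>X. cobuchi_step (aca_opts B w) (aca_rej B \<times> UNIV) X"
  let ?P1 = "{(st, j). \<forall>p q m. st = Inl (p, q, m) \<longrightarrow> p \<in> ?Q \<longrightarrow> q \<in> ?Q \<longrightarrow> ((p, q, m), j) \<in> ?L}"
  \<comment> \<open>Induction on the outer fixpoint of \<open>B\<close>. Either the flag is top and
    the round stays in \<open>?Z\<close>, which completes a Buechi step, or the move enters
    \<open>?X\<close>, where the induction hypothesis holds. Escapes are handled by
    \<open>jump\<close>.\<close>
  have "lfp ?G0 \<subseteq> ?P1"
  proof (rule lfp_induct[OF mono_cobuchi_step], fold cobuchi_def, fold aca_win_def, rule subrelI)
    let ?X = "aca_win B w \<inter> ?P1"
    let ?G = "?G0 ?X"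
    have G_win: "?G \<subseteq> aca_win B w"
      using monoD[OF mono_cobuchi_step, of ?X "aca_win B w" "aca_opts B w" "aca_rej B \<times> UNIV"]
      unfolding aca_win_def cobuchi_unfold[symmetric] by simp
    fix st j assume x: "(st, j) \<in> ?G"
    have "((p, q, m), j) \<in> ?L" if st: "st = Inl (p, q, m)" and pq: "p \<in> ?Q" "q \<in> ?Q" for p q m
    proof -
      from cobuchi_stepD[OF x]
      consider "(Inl (p, q, m), j) \<in> force (aca_opts B w) ?G" "m"
        | "(Inl (p, q, m), j) \<in> force (aca_opts B w) ?X"
        using st pq unfolding constrB_def by auto
      then show ?thesis
      proof cases
        case 1
        show ?thesis
        proof (cases "((p, q, m), j) \<in> force gopts ((\<lambda>(x, j). (Inl x, j)) -` ?G)")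
          case True
          have "((p, q, m), j) \<in> force gopts ?Z"
            by (rule restrict[OF True pq]) (use G_win in \<open>auto simp: Z1_def\<close>)
          then show ?thesis using L 1(2) by simp
        next
          case False
          then show ?thesis using 1(1) jump[OF _ _ G_win] P2 unfolding force_B_Inl by blast
        qed
      next
        case 2
        show ?thesis
        proof (cases "((p, q, m), j) \<in> force gopts ((\<lambda>(x, j). (Inl x, j)) -` ?X)")
          case True
          have "((p, q, m), j) \<in> force gopts ?L"
            by (rule restrict[OF True pq]) auto
          then show ?thesis using L by blast
        next
          case False
          then show ?thesis using 2 jump[of _ _ _ _ ?X] P2 unfolding force_B_Inl by blast
        qed
      qed
    qed
    then show "(st, j) \<in> ?P1" by blast
  qed
  then have P1: "((p, q, m), j) \<in> ?L" if "((p, q, m), j) \<in> Z1" for p q m j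
    using that unfolding Z1_def aca_win_def cobuchi_def by blast
  have "?Z \<subseteq> ?L" using P1 P2 by auto
  then have "?Z \<subseteq> buchi gopts top_pos" unfolding buchi_def by (rule gfp_upperbound)
  moreover have "((aca_init A, aca_init A, True), 0) \<in> Z1"
    using aca_accepts_win[OF assms] A unfolding Z1_def aca_wf_def constrB_def by simp
  ultimately show "((aca_init A, aca_init A, True), 0) \<in> buchi gopts top_pos" by blast
qed

lemma B_accepts_iff: "aca_accepts B w \<longleftrightarrow> dup_wins_game A u v"
  using B_accepts_if dup_wins_if by blast

end

section \<open>Lassos and the universal projection\<close>

text \<open>A run of the projection guesses primed outputs letter by letter; choice gathers the
  guesses into one word \<open>y\<close>.\<close>

lemma dd_uca_accepts_iff:
  fixes B' :: "('b, 'v + 'v) uca"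
  assumes x: "\<And>j. x j \<subseteq> Ii \<union> Oo"
  shows "uca_accepts (dd_uca Ii Oo B') (\<lambda>j. Inl ` x j) \<longleftrightarrow>
    (\<forall>y. (\<forall>j. y j \<subseteq> Oo) \<longrightarrow> uca_accepts B' (\<lambda>j. Inl ` x j \<union> Inr ` y j))"
proof -
  have diff: "full_alph Ii Oo - Inl ` (Ii \<union> Oo) = Inr ` Oo" unfolding full_alph_def by auto
  have step: "(q, Inl ` x j, q') \<in> uca_trans (dd_uca Ii Oo B') \<longleftrightarrow>
      (\<exists>y. y \<subseteq> Oo \<and> (q, Inl ` x j \<union> Inr ` y, q') \<in> uca_trans B')" for q j q'
  proof -
    have "(q, Inl ` x j, q') \<in> uca_trans (dd_uca Ii Oo B') \<longleftrightarrow>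
        (\<exists>b. b \<subseteq> Inr ` Oo \<and> (q, Inl ` x j \<union> b, q') \<in> uca_trans B')"
      using image_mono[OF x[of j], of "Inl :: 'v \<Rightarrow> 'v + 'v"]
      unfolding dd_uca_def uca_proj_def diff by simp
    then show ?thesis unfolding subset_image_iff by blast
  qed
  have run: "uca_run (dd_uca Ii Oo B') (\<lambda>j. Inl ` x j) r \<longleftrightarrow>
      (\<exists>y. (\<forall>j. y j \<subseteq> Oo) \<and> uca_run B' (\<lambda>j. Inl ` x j \<union> Inr ` y j) r)" for r
  proof -
    have "uca_init (dd_uca Ii Oo B') = uca_init B'" unfolding dd_uca_def uca_proj_def by simp
    then show ?thesis unfolding uca_run_def step by (auto dest!: choice)
  qed
  have "uca_rej (dd_uca Ii Oo B') = uca_rej B'" unfolding dd_uca_def uca_proj_def by simp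
  then show ?thesis unfolding uca_accepts_def run by auto
qed

context
  fixes Ii Oo :: "'v set" and x :: "'v word" and y :: "'v word"
  assumes x: "\<And>j. x j \<subseteq> Ii \<union> Oo" and y: "\<And>j. y j \<subseteq> Oo"
begin

lemma word_over_joint: "word_over (full_alph Ii Oo) (\<lambda>j. Inl ` x j \<union> Inr ` y j)"
  using x y unfolding word_over_def full_alph_def by blast

lemma letter_unpr_joint: "letter_unpr Ii Oo (Inl ` x j \<union> Inr ` y j) = x j"
  using x[of j] unfolding letter_unpr_def by auto

lemma letter_pr_joint: "letter_pr Ii Oo (Inl ` x j \<union> Inr ` y j) = (x j \<inter> Ii) \<union> y j"
  using y[of j] unfolding letter_pr_def by auto

end

lemma history_in_lists: "word_over Ii \<gamma> \<Longrightarrow> map \<gamma> [0..<j] \<in> lists (Pow Ii)"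
  unfolding word_over_def by (auto simp: subset_iff)

lemma strategy_outputs:
  "is_strategy Ii Oo s \<Longrightarrow> word_over Ii \<gamma> \<Longrightarrow> s (map \<gamma> [0..<j]) \<subseteq> Oo"
  using history_in_lists[of Ii \<gamma> j] unfolding is_strategy_def by simp

lemma computation_subset:
  "is_strategy Ii Oo s \<Longrightarrow> word_over Ii \<gamma> \<Longrightarrow> computation s \<gamma> j \<subseteq> Ii \<union> Oo"
  using strategy_outputs[of Ii Oo s \<gamma> j] unfolding computation_def word_over_def by (simp add: le_supI1 le_supI2)

section \<open>Ultimately periodic counterexamples\<close>

text \<open>For \<open>i < k\<close>, the index map of the ultimately periodic word with a stem of
  length \<open>i\<close> and a loop of length \<open>k - i\<close>.\<close>

fun lasso :: "nat \<Rightarrow> nat \<Rightarrow> nat \<Rightarrow> nat" where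
  "lasso i k 0 = 0"
| "lasso i k (Suc n) = (if Suc (lasso i k n) = k then i else Suc (lasso i k n))"

lemma lasso_less: "i < k \<Longrightarrow> lasso i k n < k"
  by (induction n) auto

lemma lasso_returns:
  assumes "i < k"
  shows "\<exists>n'\<ge>n. lasso i k n' = i"
proof (induction "k - lasso i k n" arbitrary: n rule: less_induct)
  case less
  show ?case
  proof (cases "Suc (lasso i k n) = k")
    case True
    then show ?thesis by (intro exI[of _ "Suc n"]) simp
  next
    case False
    then have "k - lasso i k (Suc n) < k - lasso i k n" using lasso_less[OF assms, of n] by simp
    then obtain n' where "n' \<ge> Suc n" "lasso i k n' = i" using less by blast
    then show ?thesis using Suc_leD by blast
  qed
qed

text \<open>The Moore machine is a counter below \<open>k\<close> that ignores its input.\<close>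

lemma lasso_strategy:
  assumes "i < k" and y: "\<And>j. y j \<subseteq> Oo"
  shows "is_strategy Ii Oo (\<lambda>h. y (lasso i k (length h)))"
proof -
  let ?tr = "\<lambda>m (a :: 'a set). if Suc m = k then i else Suc m"
  have "foldl ?tr 0 h = lasso i k (length h)" for h
    by (induction h rule: rev_induct) auto
  moreover have "\<forall>m \<in> {..<k}. \<forall>a. a \<subseteq> Ii \<longrightarrow> ?tr m a \<in> {..<k}" using assms(1) by auto
  ultimately have "finite_moore Ii (\<lambda>h. y (lasso i k (length h)))"
    unfolding finite_moore_def using assms(1)
    by (intro exI[of _ "{..<k}"] exI[of _ 0] exI[of _ ?tr] exI[of _ y]) auto
  then show ?thesis unfolding is_strategy_def using y by blast
qed

text \<open>Pigeonhole on pairs of a run state and a Moore state of \<open>s\<close>, over the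
  infinitely many rejecting times. Equal Moore states at \<open>i\<close> and \<open>k\<close> make
  the outputs of \<open>s\<close> on the folded input the folded outputs, so the folded run is legal
  and meets the rejecting state at \<open>i\<close> infinitely often.\<close>

lemma uca_rejects_lasso:
  fixes B' :: "('b, 'v + 'v) uca"
  assumes wf: "uca_wf \<Sigma> B'" and s: "is_strategy Ii Oo s" and \<gamma>: "word_over Ii \<gamma>"
    and rej: "\<not> uca_accepts B' (\<lambda>j. Inl ` computation s \<gamma> j \<union> Inr ` y j)"
  obtains i k where "i < k"
    and "\<not> uca_accepts B' (\<lambda>j. Inl ` computation s (\<lambda>n. \<gamma> (lasso i k n)) j \<union> Inr ` y (lasso i k j))"
proof -
  obtain r where run: "uca_run B' (\<lambda>j. Inl ` computation s \<gamma> j \<union> Inr ` y j) r"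
    and inf: "infinite {j. r j \<in> uca_rej B'}"
    using rej unfolding uca_accepts_def by blast
  obtain S :: "nat set" and m0 tr out where S: "finite S" "m0 \<in> S"
    "\<And>m a. m \<in> S \<Longrightarrow> a \<subseteq> Ii \<Longrightarrow> tr m a \<in> S"
    and out: "\<And>h. h \<in> lists (Pow Ii) \<Longrightarrow> s h = out (foldl tr m0 h)"
    using s unfolding is_strategy_def finite_moore_def by metis
  define M where "M j = foldl tr m0 (map \<gamma> [0..<j])" for j
  have M_Suc: "M (Suc j) = tr (M j) (\<gamma> j)" for j unfolding M_def by simp
  have M_in: "M j \<in> S" for j
  proof (induction j)
    case 0
    then show ?case using S(2) by (simp add: M_def)
  next
    case (Suc j)
    then show ?case using S(3) \<gamma> unfolding M_Suc word_over_def by blast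
  qed
  have r_in: "r j \<in> uca_states B'" for j
  proof (cases j)
    case 0
    then show ?thesis using run wf unfolding uca_run_def uca_wf_def by simp
  next
    case (Suc j')
    then show ?thesis using run wf unfolding uca_run_def uca_wf_def by blast
  qed
  let ?f = "\<lambda>j. (r j, M j)" and ?J = "{j. r j \<in> uca_rej B'}"
  have "finite (uca_states B')" using wf unfolding uca_wf_def by simp
  then have "finite (?f ` ?J)"
    using finite_subset[of "?f ` ?J" "uca_states B' \<times> S"] r_in M_in S(1) by auto
  then have "\<not> inj_on ?f ?J" using inf finite_imageD by blast
  then obtain i k where "i < k" and i: "r i \<in> uca_rej B'" and eq: "r i = r k" "M i = M k"
    unfolding inj_on_def by (metis (mono_tags, lifting) Pair_inject linorder_neqE_nat mem_Collect_eq)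
  let ?l = "lasso i k" and ?\<gamma> = "\<lambda>n. \<gamma> (lasso i k n)"
  have \<gamma>': "word_over Ii ?\<gamma>" using \<gamma> unfolding word_over_def by simp
  have M': "foldl tr m0 (map ?\<gamma> [0..<n]) = M (?l n)" for n
  proof (induction n)
    case 0
    then show ?case by (simp add: M_def)
  next
    case (Suc n)
    then have "foldl tr m0 (map ?\<gamma> [0..<Suc n]) = M (Suc (?l n))" by (simp add: M_Suc)
    then show ?case using eq by simp
  qed
  have comp: "computation s ?\<gamma> n = computation s \<gamma> (?l n)" for n
    using out[OF history_in_lists[OF \<gamma>'], of n] out[OF history_in_lists[OF \<gamma>], of "?l n"] M'[of n]
    unfolding computation_def M_def by simp
  have "(r (?l n), Inl ` computation s ?\<gamma> n \<union> Inr ` y (?l n), r (?l (Suc n))) \<in> uca_trans B'" for n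
  proof -
    have "r (?l (Suc n)) = r (Suc (?l n))" using eq by simp
    then show ?thesis using run unfolding uca_run_def comp by metis
  qed
  then have "uca_run B' (\<lambda>j. Inl ` computation s ?\<gamma> j \<union> Inr ` y (?l j)) (\<lambda>n. r (?l n))"
    using run unfolding uca_run_def by simp
  moreover have "infinite {j. r (?l j) \<in> uca_rej B'}"
    unfolding infinite_nat_iff_unbounded_le using lasso_returns[OF \<open>i < k\<close>] i by force
  ultimately have "\<not> uca_accepts B' (\<lambda>j. Inl ` computation s ?\<gamma> j \<union> Inr ` y (?l j))"
    unfolding uca_accepts_def by blast
  then show thesis using that \<open>i < k\<close> by blast
qed

theorem theorem15:
  fixes Ii Oo :: "'v set"
    and \<phi> :: "'v ltl"
    and A\<phi> :: "('q, 'v) aca"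
    and An\<phi> :: "('c, 'v) aca"
    and B' :: "('b, 'v + 'v) uca"
    and s :: "'v set list \<Rightarrow> 'v set"
  assumes "finite Ii" and "finite Oo" and "Ii \<inter> Oo = {}"
    and "ltl_atoms \<phi> \<subseteq> Ii \<union> Oo"
    and "aca_wf (Ii \<union> Oo) A\<phi>" and "aca_lang (Ii \<union> Oo) A\<phi> = ltl_lang (Ii \<union> Oo) \<phi>"
    and "aca_wf (Ii \<union> Oo) An\<phi>" and "aca_lang (Ii \<union> Oo) An\<phi> = ltl_lang (Ii \<union> Oo) (LNot \<phi>)"
    and "uca_wf (full_alph Ii Oo) B'"
    and "uca_lang (full_alph Ii Oo) B' = aca_lang (full_alph Ii Oo) (constrB Ii Oo A\<phi> An\<phi>)"
    and "is_strategy Ii Oo s"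
  shows "(\<forall>\<gamma>. word_over Ii \<gamma> \<longrightarrow>
            uca_accepts (dd_uca Ii Oo B') (\<lambda>j. Inl ` computation s \<gamma> j))
         \<longleftrightarrow> delay_dominant Ii Oo A\<phi> s"
proof -
  note s = assms(11)
  have complement: "aca_accepts An\<phi> x \<longleftrightarrow> \<not> aca_accepts A\<phi> x" if "word_over (Ii \<union> Oo) x" for x
  proof -
    have "aca_accepts A\<phi> x \<longleftrightarrow> ltl_sat x \<phi>" "aca_accepts An\<phi> x \<longleftrightarrow> ltl_sat x (LNot \<phi>)"
      using assms(6,8) that unfolding aca_lang_def ltl_lang_def by blast+
    then show ?thesis by simp
  qed
  have accepts_iff: "uca_accepts B' (\<lambda>j. Inl ` computation s \<gamma> j \<union> Inr ` t (map \<gamma> [0..<j])) \<longleftrightarrow>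
      delay_dominates A\<phi> s t \<gamma>"
    if \<gamma>: "word_over Ii \<gamma>" and t: "is_strategy Ii Oo t" for \<gamma> t
  proof -
    let ?w = "\<lambda>j. Inl ` computation s \<gamma> j \<union> Inr ` t (map \<gamma> [0..<j])"
    note xy = computation_subset[OF s \<gamma>] strategy_outputs[OF t \<gamma>]
    have unpr: "letter_unpr Ii Oo (?w j) = computation s \<gamma> j" for j
      by (rule letter_unpr_joint[OF xy])
    \<comment> \<open>Disjointness of inputs and outputs recovers \<open>\<gamma>\<close>, so the
      primed half of the joint word is exactly the computation of \<open>t\<close>.\<close>
    have "computation s \<gamma> j \<inter> Ii = \<gamma> j" for j
      using strategy_outputs[OF s \<gamma>, of j] \<gamma> assms(3) unfolding computation_def word_over_def by blast
    then have pr: "letter_pr Ii Oo (?w j) = computation t \<gamma> j" for j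
      using letter_pr_joint[OF xy] by (simp add: computation_def)
    interpret dominance_automaton Ii Oo A\<phi> An\<phi> ?w
      by (rule dominance_automaton.intro[OF assms(5) assms(7) complement])
    have "uca_accepts B' ?w \<longleftrightarrow> aca_accepts (constrB Ii Oo A\<phi> An\<phi>) ?w"
      using word_over_joint[OF xy] assms(10)[unfolded uca_lang_def aca_lang_def set_eq_iff, rule_format, of ?w]
      by simp
    then show ?thesis using B_accepts_iff unfolding delay_dominates_def unpr pr by simp
  qed
  have dd: "uca_accepts (dd_uca Ii Oo B') (\<lambda>j. Inl ` computation s \<gamma> j) \<longleftrightarrow>
      (\<forall>y. (\<forall>j. y j \<subseteq> Oo) \<longrightarrow> uca_accepts B' (\<lambda>j. Inl ` computation s \<gamma> j \<union> Inr ` y j))"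
    if "word_over Ii \<gamma>" for \<gamma>
    by (rule dd_uca_accepts_iff[OF computation_subset[OF s that]])
  show ?thesis
  proof
    assume acc: "\<forall>\<gamma>. word_over Ii \<gamma> \<longrightarrow>
        uca_accepts (dd_uca Ii Oo B') (\<lambda>j. Inl ` computation s \<gamma> j)"
    show "delay_dominant Ii Oo A\<phi> s"
      unfolding delay_dominant_def
    proof (intro allI impI)
      fix t \<gamma> assume t: "is_strategy Ii Oo t" and \<gamma>: "word_over Ii \<gamma>"
      have "uca_accepts B' (\<lambda>j. Inl ` computation s \<gamma> j \<union> Inr ` t (map \<gamma> [0..<j]))"
        using acc dd[OF \<gamma>] \<gamma> strategy_outputs[OF t \<gamma>] by simp
      then show "delay_dominates A\<phi> s t \<gamma>" using accepts_iff[OF \<gamma> t] by simp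
    qed
  next
    assume dominant: "delay_dominant Ii Oo A\<phi> s"
    show "\<forall>\<gamma>. word_over Ii \<gamma> \<longrightarrow>
        uca_accepts (dd_uca Ii Oo B') (\<lambda>j. Inl ` computation s \<gamma> j)"
    proof (intro allI impI, rule ccontr)
      fix \<gamma> assume \<gamma>: "word_over Ii \<gamma>"
        and "\<not> uca_accepts (dd_uca Ii Oo B') (\<lambda>j. Inl ` computation s \<gamma> j)"
      then obtain y where y: "\<And>j. y j \<subseteq> Oo"
        and rej: "\<not> uca_accepts B' (\<lambda>j. Inl ` computation s \<gamma> j \<union> Inr ` y j)"
        unfolding dd[OF \<gamma>] by blast
      \<comment> \<open>\<open>y\<close> need not be the output of a finite-state strategy. The
        lasso replaces \<open>\<gamma>\<close> and \<open>y\<close> by ultimately periodic words,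
        and the new \<open>y\<close> is produced by a counter.\<close>
      obtain i k where ik: "i < k" and rej':
        "\<not> uca_accepts B' (\<lambda>j. Inl ` computation s (\<lambda>n. \<gamma> (lasso i k n)) j \<union> Inr ` y (lasso i k j))"
        using uca_rejects_lasso[OF assms(9) s \<gamma> rej] by metis
      let ?\<gamma> = "\<lambda>n. \<gamma> (lasso i k n)" and ?t = "\<lambda>h :: 'v set list. y (lasso i k (length h))"
      have t: "is_strategy Ii Oo ?t" by (rule lasso_strategy[OF ik y])
      have \<gamma>': "word_over Ii ?\<gamma>" using \<gamma> unfolding word_over_def by simp
      have "delay_dominates A\<phi> s ?t ?\<gamma>" using dominant t \<gamma>' unfolding delay_dominant_def by blast
      then show False using accepts_iff[OF \<gamma>' t] rej' by simp
    qed
  qed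
qed

end
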